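(* Every exactly $3$-edge-connected multigraph $G$ can be obtained, up to isomorphism, from dumbbell graphs by a finite number of operations, each of which is either a cycle expansion or a block gluing. That is, the smallest isomorphism-closed class of multigraphs that contains the dumbbell graph, is closed under block gluing of two (vertex-disjoint copies of) members, and is closed under cycle expansion of biconnected members, contains every exactly $3$-edge-connected multigraph.
   Context: All graphs are finite undirected multigraphs (parallel edges allowed) without loops; edge sets and neighbor lists are multisets. A multigraph $G$ with at least two vertices is exactly $k$-edge-connected if for every pair of distinct vertices $u,v$ the maximum number of pairwise edge-disjoint paths between $u$ and $v$ is exactly $k$ (parallel edges count as distinct edges). An articulation point of a connected graph is a vertex whose removal disconnects it. A graph is biconnected if it is connected and has no articulation point (so the dumbbell graph is biconnected). Dumbbell graph: two vertices joined by $3$ parallel edges. Block gluing: given vertex-disjoint $G_1,G_2$ and vertices $u_1\in V(G_1)$, $u_2\in V(G_2)$, form the graph obtained from the disjoint union of $G_1$ and $G_2$ by identifying $u_1$ and $u_2$ into one vertex $u$ (keeping all edges). Cycle expansion: given a biconnected exactly $3$-edge-connected multigraph $G=(V,E)$, a vertex $u$ of degree $d$, an enumeration $v_1,\dots,v_d$ of the neighbors of $u$ (listed with multiplicity, one for each edge incident to $u$), and an integer $2\le d'\le d$, delete $u$, add new vertices $u_1,\dots,u_{d'}$, add the edges of the cycle $u_1u_2\cdots u_{d'}u_1$ (a double edge between $u_1$ and $u_2$ when $d'=2$), add the edges $(u_i,v_i)$ for $1\le i\le d'-1$, and the edges $(u_{d'},v_i)$ for $d'\le i\le d$. *)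

theory Defs
  imports "HOL-Library.Multiset"
begin

record 'a mgraph =
  verts :: "'a set"
  edges :: "'a set multiset"

definition multigraph :: "'a mgraph \<Rightarrow> bool" where
  "multigraph G \<longleftrightarrow> finite (verts G) \<and> (\<forall>e\<in>#edges G. e \<subseteq> verts G \<and> card e = 2)"

definition mgraph_iso :: "'a mgraph \<Rightarrow> 'b mgraph \<Rightarrow> bool" where
  "mgraph_iso G H \<longleftrightarrow>
     (\<exists>f. bij_betw f (verts G) (verts H) \<and> edges H = image_mset (image f) (edges G))"

fun path_edges :: "'a list \<Rightarrow> 'a set multiset" where
  "path_edges (x # y # xs) = add_mset {x, y} (path_edges (y # xs))"
| "path_edges _ = {#}"

definition is_path :: "'a mgraph \<Rightarrow> 'a \<Rightarrow> 'a list \<Rightarrow> 'a \<Rightarrow> bool" where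
  "is_path G u p v \<longleftrightarrow> p \<noteq> [] \<and> hd p = u \<and> last p = v \<and> distinct p \<and>
     set p \<subseteq> verts G \<and> path_edges p \<subseteq># edges G"

text \<open>A path records only its vertices, so several entries of the list \<open>ps\<close> may coincide. The
  multiset inclusion says that the traversed edges can be chosen to be pairwise distinct: each
  edge is used, over all paths together, at most as often as its multiplicity in \<open>G\<close>.\<close>

definition edge_disjoint_paths :: "'a mgraph \<Rightarrow> 'a \<Rightarrow> 'a \<Rightarrow> 'a list list \<Rightarrow> bool" where
  "edge_disjoint_paths G u v ps \<longleftrightarrow>
     (\<forall>p\<in>set ps. is_path G u p v) \<and> sum_list (map path_edges ps) \<subseteq># edges G"

definition exactly_edge_connected :: "nat \<Rightarrow> 'a mgraph \<Rightarrow> bool" where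
  "exactly_edge_connected k G \<longleftrightarrow> card (verts G) \<ge> 2 \<and>
     (\<forall>u\<in>verts G. \<forall>v\<in>verts G. u \<noteq> v \<longrightarrow>
        (\<exists>ps. edge_disjoint_paths G u v ps \<and> length ps = k) \<and>
        (\<forall>ps. edge_disjoint_paths G u v ps \<longrightarrow> length ps \<le> k))"

text \<open>One-vertex graphs are connected, so the dumbbell graph has no articulation point.\<close>

definition connected_mgraph :: "'a mgraph \<Rightarrow> bool" where
  "connected_mgraph G \<longleftrightarrow> (\<forall>u\<in>verts G. \<forall>v\<in>verts G. \<exists>p. is_path G u p v)"

definition remove_vertex :: "'a mgraph \<Rightarrow> 'a \<Rightarrow> 'a mgraph" where
  "remove_vertex G u = \<lparr>verts = verts G - {u}, edges = {#e \<in># edges G. u \<notin> e#}\<rparr>"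

definition articulation_point :: "'a mgraph \<Rightarrow> 'a \<Rightarrow> bool" where
  "articulation_point G u \<longleftrightarrow>
     connected_mgraph G \<and> u \<in> verts G \<and> \<not> connected_mgraph (remove_vertex G u)"

definition biconnected :: "'a mgraph \<Rightarrow> bool" where
  "biconnected G \<longleftrightarrow> connected_mgraph G \<and> (\<nexists>u. articulation_point G u)"

definition neighbors :: "'a mgraph \<Rightarrow> 'a \<Rightarrow> 'a multiset" where
  "neighbors G u = image_mset (\<lambda>e. the_elem (e - {u})) {#e \<in># edges G. u \<in> e#}"

definition dumbbell :: "'a \<Rightarrow> 'a \<Rightarrow> 'a mgraph" where
  "dumbbell a b = \<lparr>verts = {a, b}, edges = replicate_mset 3 {a, b}\<rparr>"

text \<open>The merged vertex keeps the name \<open>u\<^sub>1\<close>. Meaningful if \<open>verts G\<^sub>1 \<inter> verts G\<^sub>2 = {}\<close>.\<close>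

definition block_gluing :: "'a mgraph \<Rightarrow> 'a \<Rightarrow> 'a mgraph \<Rightarrow> 'a \<Rightarrow> 'a mgraph" where
  "block_gluing G\<^sub>1 u\<^sub>1 G\<^sub>2 u\<^sub>2 = (let f = id(u\<^sub>2 := u\<^sub>1) in
     \<lparr>verts = f ` (verts G\<^sub>1 \<union> verts G\<^sub>2),
      edges = image_mset (image f) (edges G\<^sub>1 + edges G\<^sub>2)\<rparr>)"

text \<open>For a list of length two this is a double edge.\<close>

definition cycle_edges :: "'a list \<Rightarrow> 'a set multiset" where
  "cycle_edges us =
     mset (map (\<lambda>i. {us ! i, us ! (Suc i mod length us)}) [0..<length us])"

text \<open>Here \<open>vs\<close> enumerates the neighbors of \<open>u\<close> and \<open>us\<close> the new vertices. Lists are indexed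
  from 0, so the last new vertex is \<open>us ! (d' - 1)\<close>.\<close>

definition cycle_expansion :: "'a mgraph \<Rightarrow> 'a \<Rightarrow> 'a list \<Rightarrow> 'a list \<Rightarrow> 'a mgraph" where
  "cycle_expansion G u vs us = (let d = length vs; d' = length us in
     \<lparr>verts = (verts G - {u}) \<union> set us,
      edges = edges (remove_vertex G u) + cycle_edges us
        + mset (map (\<lambda>i. {us ! i, vs ! i}) [0..<d' - 1])
        + mset (map (\<lambda>i. {us ! (d' - 1), vs ! i}) [d' - 1..<d])\<rparr>)"

text \<open>Vertices are natural numbers because the operations need fresh vertices and disjoint copies;
  every finite multigraph is isomorphic to one with vertices in \<open>nat\<close>.\<close>

inductive constructible :: "nat mgraph \<Rightarrow> bool" where
  constructible_dumbbell:
    "a \<noteq> b \<Longrightarrow> constructible (dumbbell a b)"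
| constructible_iso:
    "constructible G \<Longrightarrow> mgraph_iso G H \<Longrightarrow> constructible H"
| constructible_gluing:
    "constructible G\<^sub>1 \<Longrightarrow> constructible G\<^sub>2 \<Longrightarrow> verts G\<^sub>1 \<inter> verts G\<^sub>2 = {} \<Longrightarrow>
     u\<^sub>1 \<in> verts G\<^sub>1 \<Longrightarrow> u\<^sub>2 \<in> verts G\<^sub>2 \<Longrightarrow> constructible (block_gluing G\<^sub>1 u\<^sub>1 G\<^sub>2 u\<^sub>2)"
| constructible_expansion:
    "constructible G \<Longrightarrow> biconnected G \<Longrightarrow> exactly_edge_connected 3 G \<Longrightarrow>
     u \<in> verts G \<Longrightarrow> mset vs = neighbors G u \<Longrightarrow>
     distinct us \<Longrightarrow> set us \<inter> verts G = {} \<Longrightarrow>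
     2 \<le> length us \<Longrightarrow> length us \<le> length vs \<Longrightarrow>
     constructible (cycle_expansion G u vs us)"

end

theory Submission
  imports Defs
begin

text \<open>
  The construction is found by taking a graph apart, by induction on the number of vertices. A graph
  with two vertices is a dumbbell. A larger one either has an articulation point, and then it is
  the block gluing of its two sides, or it contains a cycle whose contraction to a single vertex
  leaves a smaller biconnected exactly 3-edge-connected graph, and then it is a cycle expansion of
  that graph.

  By Menger's theorem (\<open>menger\<close>, proved with integral flows) being exactly 3-edge-connected means
  that every cut has at least three edges and that every two vertices are separated by a cut with
  exactly three. So only the multiplicity \<open>w x y\<close> of each pair of vertices matters, and
  everything reduces to counting edges between vertex sets. A vertex set whose cut has exactly
  three edges is called tight.

  The heart is the choice of the cycle in a biconnected graph (\<open>contractible_cycle\<close>). The cycle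
  must have no chord, all its vertices but one must have degree three, its complement must be
  connected (this makes the contracted graph biconnected), and enough tight sets must avoid it to
  separate the vertices of the contracted graph. As three is odd, two tight sets never cross
  (\<open>tight_uncross\<close>). Let \<open>X\<close> be a minimal tight set with at least two vertices. Two vertices
  of \<open>X\<close> are separated by a tight set inside \<open>X\<close>, which by minimality is a singleton; so all
  vertices of \<open>X\<close> except possibly one, \<open>s\<close>, have degree three (\<open>almost_cubic_side\<close>). A cycle
  through \<open>s\<close> inside \<open>X\<close> meets the requirement on tight sets: vertices outside \<open>X\<close> are
  separated by tight sets that do not cross \<open>X\<close>, the set \<open>V - X\<close> itself is tight, and the vertices
  of \<open>X\<close> off the cycle are tight singletons.

  For the connected complement, grow the side \<open>V - X\<close> to a connected set \<open>K\<close> that avoids \<open>s\<close> and is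
  as large as possible among those that leave some cycle through \<open>s\<close> in \<open>V - K\<close>. A vertex
  \<open>c \<noteq> s\<close> of \<open>V - K\<close> next to \<open>K\<close> cannot be moved to \<open>K\<close>, so it lies on every remaining
  cycle through \<open>s\<close>; and it has degree three, one edge of which goes to \<open>K\<close>. Hence removing \<open>c\<close>
  cuts \<open>V - K - {s}\<close> into at most two pieces of the same kind, and by induction
  (\<open>corridor_is_path\<close>) \<open>V - K\<close> is nothing but a cycle, each of whose vertices other than \<open>s\<close> has
  exactly one edge to \<open>K\<close>. That is the shape of the cycle in a cycle expansion, with \<open>s\<close> as the last of
  its vertices (\<open>expansion_of_contraction\<close>).
\<close>

section \<open>Edges between vertex sets and connectedness\<close>

definition edges_between :: "('a \<Rightarrow> 'a \<Rightarrow> nat) \<Rightarrow> 'a set \<Rightarrow> 'a set \<Rightarrow> nat" where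
  "edges_between w A B = (\<Sum>x\<in>A. \<Sum>y\<in>B. w x y)"

text \<open>Connectedness is expressed by cuts instead of walks, so that it can be used in counting arguments.
  The empty set counts as connected.\<close>
definition connected_on :: "('a \<Rightarrow> 'a \<Rightarrow> nat) \<Rightarrow> 'a set \<Rightarrow> bool" where
  "connected_on w S \<longleftrightarrow> (\<forall>A. A \<subseteq> S \<longrightarrow> A \<noteq> {} \<longrightarrow> A \<noteq> S \<longrightarrow> 0 < edges_between w A (S - A))"

definition component_of :: "('a \<Rightarrow> 'a \<Rightarrow> nat) \<Rightarrow> 'a set \<Rightarrow> 'a set \<Rightarrow> bool" where
  "component_of w M S \<longleftrightarrow> M \<subseteq> S \<and> M \<noteq> {} \<and> connected_on w M \<and> edges_between w M (S - M) = 0"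

lemma eb_split_left:
  assumes "finite A" "A' \<subseteq> A"
  shows "edges_between w A B = edges_between w A' B + edges_between w (A - A') B"
  unfolding edges_between_def using sum.subset_diff[OF assms(2,1)] by (simp add: add.commute)

lemma eb_split_right:
  assumes "finite B" "B' \<subseteq> B"
  shows "edges_between w A B = edges_between w A B' + edges_between w A (B - B')"
  unfolding edges_between_def
  by (simp add: sum.subset_diff[OF assms(2,1)] add.commute sum.distrib)

lemma eb_Un_left:
  assumes "finite A" "finite B" "A \<inter> B = {}"
  shows "edges_between w (A \<union> B) C = edges_between w A C + edges_between w B C"
  unfolding edges_between_def by (rule sum.union_disjoint[OF assms])

lemma eb_Un_right:
  assumes "finite A" "finite B" "A \<inter> B = {}"
  shows "edges_between w C (A \<union> B) = edges_between w C A + edges_between w C B"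
  unfolding edges_between_def by (simp add: sum.union_disjoint[OF assms] sum.distrib)

lemma eb_empty [simp]: "edges_between w {} B = 0" "edges_between w A {} = 0"
  by (simp_all add: edges_between_def)

lemma eb_pos_iff:
  assumes "finite A" "finite B"
  shows "0 < edges_between w A B \<longleftrightarrow> (\<exists>x\<in>A. \<exists>y\<in>B. 0 < w x y)"
proof -
  have "edges_between w A B = 0 \<longleftrightarrow> (\<forall>x\<in>A. \<forall>y\<in>B. w x y = 0)"
    unfolding edges_between_def using assms by simp
  then show ?thesis by auto
qed

lemma eb_mono:
  assumes "finite A" "finite B" "A' \<subseteq> A" "B' \<subseteq> B"
  shows "edges_between w A' B' \<le> edges_between w A B"
proof -
  have "edges_between w A' B' \<le> edges_between w A' B"
    unfolding edges_between_def using assms by (intro sum_mono sum_mono2) auto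
  also have "\<dots> \<le> edges_between w A B"
    unfolding edges_between_def using assms by (intro sum_mono2) auto
  finally show ?thesis .
qed

lemma eb_singleton: "edges_between w {x} B = (\<Sum>y\<in>B. w x y)" "edges_between w A {y} = (\<Sum>x\<in>A. w x y)"
  by (simp_all add: edges_between_def)

lemma eb_cong:
  assumes "\<And>x y. x \<in> A \<Longrightarrow> y \<in> B \<Longrightarrow> w x y = w' x y"
  shows "edges_between w A B = edges_between w' A B"
  unfolding edges_between_def using assms by (intro sum.cong) auto

lemma connected_on_cong:
  assumes "\<And>x y. x \<in> S \<Longrightarrow> y \<in> S \<Longrightarrow> w x y = w' x y"
  shows "connected_on w S \<longleftrightarrow> connected_on w' S"
proof -
  have "edges_between w A (S - A) = edges_between w' A (S - A)" if "A \<subseteq> S" for A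
    using that assms by (intro eb_cong) auto
  then show ?thesis unfolding connected_on_def by metis
qed

lemma connected_on_singleton: "connected_on w {x}"
  unfolding connected_on_def by (metis subset_singletonD)

locale multiplicity =
  fixes w :: "'a \<Rightarrow> 'a \<Rightarrow> nat"
  assumes sym: "w x y = w y x" and loopless [simp]: "w x x = 0"
begin

abbreviation eb where "eb \<equiv> edges_between w"

lemma eb_sym: "eb A B = eb B A"
proof -
  have "eb A B = (\<Sum>x\<in>A. \<Sum>y\<in>B. w y x)" by (simp add: edges_between_def sym)
  also have "\<dots> = eb B A" unfolding edges_between_def by (rule sum.swap)
  finally show ?thesis .
qed

text \<open>A violating cut and its complement violate alike, so only the one that misses a fixed vertex has
  to be examined.\<close>
lemma connected_onI:
  assumes "c \<in> S" "\<And>A. A \<subseteq> S \<Longrightarrow> A \<noteq> {} \<Longrightarrow> c \<notin> A \<Longrightarrow> 0 < eb A (S - A)"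
  shows "connected_on w S"
  unfolding connected_on_def
proof (intro allI impI)
  fix A assume A: "A \<subseteq> S" "A \<noteq> {}" "A \<noteq> S"
  show "0 < eb A (S - A)"
  proof (cases "c \<in> A")
    case False then show ?thesis using A assms(2) by blast
  next
    case True
    then have "0 < eb (S - A) (S - (S - A))" using A assms(2)[of "S - A"] by blast
    moreover have "S - (S - A) = A" using A by auto
    ultimately show ?thesis using eb_sym by metis
  qed
qed

lemma connected_on_Un:
  assumes "finite A" "finite B" "connected_on w A" "connected_on w B"
    and "x \<in> A" "y \<in> B" "x = y \<or> 0 < w x y"
  shows "connected_on w (A \<union> B)"
proof (rule connected_onI[of x])
  show "x \<in> A \<union> B" using assms by auto
  fix C assume C: "C \<subseteq> A \<union> B" "C \<noteq> {}" "x \<notin> C"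
  let ?D = "A \<union> B - C"
  have "\<exists>a\<in>C. \<exists>b\<in>?D. 0 < w a b"
  proof (cases "C \<inter> A = {}")
    case False
    then have "0 < eb (C \<inter> A) (A - C \<inter> A)" using assms(3,5) C
      unfolding connected_on_def by (elim allE[of _ "C \<inter> A"]) auto
    then show ?thesis using assms(1) by (subst (asm) eb_pos_iff) auto
  next
    case True
    then have CB: "C \<subseteq> B" using C by auto
    show ?thesis
    proof (cases "C = B")
      case False
      then have "0 < eb C (B - C)" using assms(4) CB C unfolding connected_on_def by blast
      then show ?thesis using assms(2) finite_subset[OF CB] by (subst (asm) eb_pos_iff) auto
    next
      case True
      then show ?thesis using assms(5-7) C sym by (metis Diff_iff UnI1)
    qed
  qed
  then show "0 < eb C ?D" using C assms(1,2) finite_subset[of C "A \<union> B"]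
    by (subst eb_pos_iff) auto
qed

lemma connected_on_insert:
  assumes "finite A" "connected_on w A" "x \<in> A" "0 < w x y"
  shows "connected_on w (insert y A)"
  using connected_on_Un[OF assms(1) _ assms(2) connected_on_singleton assms(3), of y] assms(4) by simp

text \<open>The component of a vertex is a smallest set around it with no edges to the rest.\<close>
lemma component_exists:
  assumes "finite S" "x \<in> S"
  obtains M where "component_of w M S" "x \<in> M"
proof -
  define P where "P M \<longleftrightarrow> M \<subseteq> S \<and> x \<in> M \<and> eb M (S - M) = 0" for M
  have "P S" using assms by (simp add: P_def)
  then obtain M where M: "P M" and min: "\<And>M'. P M' \<Longrightarrow> card M \<le> card M'"
    using ex_has_least_nat[of P S card] by blast
  have fin: "finite M" using M assms finite_subset P_def by metis
  have "connected_on w M"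
  proof (rule connected_onI[of x])
    show "x \<in> M" using M P_def by auto
    fix A assume A: "A \<subseteq> M" "A \<noteq> {}" "x \<notin> A"
    show "0 < eb A (M - A)"
    proof (rule ccontr)
      assume *: "\<not> 0 < eb A (M - A)"
      have "eb (M - A) (S - (M - A)) = 0"
      proof (rule ccontr)
        assume "eb (M - A) (S - (M - A)) \<noteq> 0"
        then obtain a b where ab: "a \<in> M - A" "b \<in> S - (M - A)" "0 < w a b"
          using eb_pos_iff[of "M - A" "S - (M - A)" w] fin assms by auto
        have "\<not> (\<exists>x\<in>M. \<exists>y\<in>S - M. 0 < w x y)"
          using M eb_pos_iff[of M "S - M" w] fin assms(1) by (simp add: P_def)
        then have "b \<in> A" using ab by auto
        moreover have "\<not> (\<exists>x\<in>A. \<exists>y\<in>M - A. 0 < w x y)"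
          using * eb_pos_iff[of A "M - A" w] fin finite_subset[OF A(1) fin] by simp
        ultimately show False using ab sym[of a b] by auto
      qed
      then have "P (M - A)" using M A by (auto simp: P_def)
      then have "card M \<le> card (M - A)" using min by auto
      moreover have "card (M - A) < card M" using A fin by (intro psubset_card_mono) auto
      ultimately show False by simp
    qed
  qed
  then have "component_of w M S" using M by (auto simp: P_def component_of_def)
  then show thesis using that M by (auto simp: P_def)
qed

lemma component_absorbs:
  assumes "finite S" "component_of w M S" "connected_on w Z" "Z \<subseteq> S" "Z \<inter> M \<noteq> {}"
  shows "Z \<subseteq> M"
proof (rule ccontr)
  assume "\<not> Z \<subseteq> M"
  then have "0 < eb (Z \<inter> M) (Z - Z \<inter> M)" using assms(3,5)
    unfolding connected_on_def by (elim allE[of _ "Z \<inter> M"]) auto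
  also have "\<dots> \<le> eb M (S - M)"
    using assms unfolding component_of_def by (intro eb_mono) (auto intro: finite_subset)
  also have "\<dots> = 0" using assms unfolding component_of_def by simp
  finally show False by simp
qed

lemma component_of_remainder:
  assumes "finite S" "component_of w M S" "component_of w N (S - M)"
  shows "component_of w N S"
proof -
  have N: "N \<subseteq> S - M" "eb N (S - M - N) = 0" and M: "M \<subseteq> S" "eb M (S - M) = 0"
    using assms(2,3) by (auto simp: component_of_def)
  have "eb N M \<le> eb (S - M) M"
    using assms(1) M N finite_subset by (intro eb_mono) auto
  then have "eb N M = 0" using M eb_sym by (metis le_zero_eq)
  moreover have "eb N (S - N) = eb N M + eb N (S - M - N)"
  proof -
    have "S - N - M = S - M - N" "M \<subseteq> S - N" using M N by auto
    then show ?thesis using eb_split_right[of "S - N" M w N] assms(1) by simp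
  qed
  ultimately show ?thesis using assms(3) N by (auto simp: component_of_def)
qed

text \<open>This is how edge counts of a disconnected set are bounded: it suffices to bound them on each
  component.\<close>
lemma sum_le_sum_by_components:
  assumes "finite S" "\<And>M. component_of w M S \<Longrightarrow> sum f M \<le> (sum g M :: nat)"
  shows "sum f S \<le> sum g S"
  using assms
proof (induction "card S" arbitrary: S rule: less_induct)
  case less
  show ?case
  proof (cases "S = {}")
    case False
    then obtain x M where M: "component_of w M S" "x \<in> M" using component_exists less.prems by blast
    then have sub: "M \<subseteq> S" by (simp add: component_of_def)
    have "card (S - M) < card S" using M sub less.prems(1) by (intro psubset_card_mono) auto
    then have "sum f (S - M) \<le> sum g (S - M)"
      using less.hyps[of "S - M"] less.prems component_of_remainder[OF less.prems(1) M(1)] by auto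
    moreover have "sum f M \<le> sum g M" using less.prems M by auto
    ultimately show ?thesis using sum.subset_diff[OF sub less.prems(1)] by (metis add_mono)
  qed simp
qed

end

section \<open>Corridors\<close>

lemma path_edges_subset: "e \<in># path_edges L \<Longrightarrow> e \<subseteq> set L"
  by (induction L rule: path_edges.induct) auto

lemma count_path_edges_notin: "u \<notin> set L \<Longrightarrow> count (path_edges L) {u, v} = 0" "u \<notin> set L \<Longrightarrow> count (path_edges L) {v, u} = 0"
  using path_edges_subset[of "{u, v}" L] path_edges_subset[of "{v, u}" L] by (auto simp: count_eq_zero_iff)

lemma path_edges_append: "path_edges (xs @ c # ys) = path_edges (xs @ [c]) + path_edges (c # ys)"
  by (induction xs rule: path_edges.induct) auto

lemma count_path_edges_snoc:
  "count (path_edges (xs @ [c])) e = count (path_edges xs) e + of_bool (xs \<noteq> [] \<and> e = {last xs, c})"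
  by (induction xs rule: path_edges.induct) auto

lemma count_path_edges_Cons:
  "count (path_edges (c # ys)) e = count (path_edges ys) e + of_bool (ys \<noteq> [] \<and> e = {c, hd ys})"
  by (cases ys) auto

context multiplicity
begin

text \<open>A corridor \<open>D\<close> is a piece of \<open>V - K - {s}\<close> as it arises in the search for a cycle. The functions \<open>p\<close>
  and \<open>q\<close> count, for each vertex, the edges to what lies before and behind the corridor; there is one
  edge of each kind. The function \<open>k\<close> counts the edges to \<open>K\<close>. The fifth condition is
  3-edge-connectedness, the sixth says that vertices next to \<open>K\<close> have degree three, and the last one
  that each of them blocks every passage through the corridor.\<close>
definition corridor :: "('a \<Rightarrow> nat) \<Rightarrow> 'a set \<Rightarrow> ('a \<Rightarrow> nat) \<Rightarrow> ('a \<Rightarrow> nat) \<Rightarrow> bool" where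
  "corridor k D p q \<longleftrightarrow> finite D \<and> connected_on w D \<and> sum p D = 1 \<and> sum q D = 1 \<and>
     (\<forall>S. S \<subseteq> D \<longrightarrow> S \<noteq> {} \<longrightarrow> 3 \<le> sum p S + sum q S + sum k S + eb S (D - S)) \<and>
     (\<forall>c\<in>D. 0 < k c \<longrightarrow> p c + q c + k c + eb {c} D \<le> 3) \<and>
     (\<forall>c\<in>D. 0 < k c \<longrightarrow> (\<forall>S. S \<subseteq> D - {c} \<longrightarrow> connected_on w S \<longrightarrow> sum p S = 0 \<or> sum q S = 0))"

lemma corridor_sym: "corridor k D p q \<Longrightarrow> corridor k D q p"
  unfolding corridor_def
  by (simp add: add.commute[of "sum q _" "sum p _"] add.commute[of "q _" "p _"] disj_commute)

text \<open>Every component of \<open>D - {c}\<close> has an edge to \<open>c\<close>, because \<open>D\<close> is connected, and contains at most one of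
  the two ends of the corridor, because \<open>c\<close> blocks the passage. So the number of ends does not exceed the
  number of edges at \<open>c\<close> that do not go to \<open>K\<close>. There are two ends and at most two such edges, and
  equality holds throughout.\<close>
lemma corridor_cut:
  assumes D: "corridor k D p q" and c: "c \<in> D" "0 < k c"
  shows "k c = 1" and "component_of w M (D - {c}) \<Longrightarrow> sum p M + sum q M = 1"
    and "component_of w M (D - {c}) \<Longrightarrow> eb M {c} = 1"
proof -
  have fin: "finite D" and conn: "connected_on w D" and sums: "sum p D = 1" "sum q D = 1"
    and deg: "p c + q c + k c + eb {c} D \<le> 3"
    and sep: "\<And>S. S \<subseteq> D - {c} \<Longrightarrow> connected_on w S \<Longrightarrow> sum p S = 0 \<or> sum q S = 0"
    using D c by (auto simp: corridor_def)
  define f where "f v = p v + q v" for v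
  define g where "g v = w v c" for v
  have g: "sum g M = eb M {c}" for M by (simp add: g_def eb_singleton)
  have f: "sum f M = sum p M + sum q M" for M by (simp add: f_def sum.distrib)
  have bounds: "sum f M \<le> 1 \<and> 1 \<le> sum g M" if M: "component_of w M (D - {c})" for M
  proof
    have MD: "M \<subseteq> D - {c}" "M \<noteq> {}" "connected_on w M" "eb M (D - {c} - M) = 0"
      using M by (auto simp: component_of_def)
    have "sum p M \<le> sum p D" "sum q M \<le> sum q D"
      using MD fin by (auto intro!: sum_mono2)
    then show "sum f M \<le> 1" using sums sep[OF MD(1,3)] f by auto
    have "0 < eb M (D - M)" using conn MD c unfolding connected_on_def by blast
    moreover have "eb M (D - M) = eb M {c} + eb M (D - {c} - M)"
    proof -
      have "D - M - {c} = D - {c} - M" "{c} \<subseteq> D - M" using MD c by auto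
      then show ?thesis using eb_split_right[of "D - M" "{c}" w M] fin by simp
    qed
    ultimately show "1 \<le> sum g M" using MD g[of M] by linarith
  qed
  have split: "sum h D = h c + sum h (D - {c})" for h :: "'a \<Rightarrow> nat"
    using sum.remove[OF fin c(1)] .
  have gc: "eb {c} D = sum g (D - {c})"
    using split[of g] by (simp add: eb_singleton g_def sym)
  have le: "sum f S \<le> sum g S" if "component_of w M (D - {c}) \<and> S = D - {c} - M \<or> S = D - {c}" for S M
  proof (rule sum_le_sum_by_components)
    show "finite S" using that fin by auto
    fix N assume N: "component_of w N S"
    have "component_of w N (D - {c})"
      using that N component_of_remainder[of "D - {c}" M N] fin by auto
    then show "sum f N \<le> sum g N" using bounds by fastforce
  qed
  have tot: "sum f D = 2" using f sums by simp
  have 1: "sum f (D - {c}) \<le> sum g (D - {c})" using le by blast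
  show "k c = 1" using tot 1 split[of f] deg gc c by (simp add: f_def)
  have eq: "sum f (D - {c}) = sum g (D - {c})" using tot 1 split[of f] deg gc c by (simp add: f_def)
  have "sum f M = 1 \<and> sum g M = 1" if M: "component_of w M (D - {c})"
  proof -
    have "sum h (D - {c}) = sum h (D - {c} - M) + sum h M" for h :: "'a \<Rightarrow> nat"
      using sum.subset_diff[of M "D - {c}"] M fin by (simp add: component_of_def)
    then have "sum f (D - {c} - M) + sum f M = sum g (D - {c} - M) + sum g M" using eq by metis
    moreover have "sum f (D - {c} - M) \<le> sum g (D - {c} - M)" using le M by blast
    ultimately show ?thesis using bounds[OF M] by simp
  qed
  then show "component_of w M (D - {c}) \<Longrightarrow> sum p M + sum q M = 1"
    "component_of w M (D - {c}) \<Longrightarrow> eb M {c} = 1" using f g by auto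
qed

lemma connected_on_minus_component:
  assumes "finite D" "connected_on w D" "c \<in> D" and M: "component_of w M (D - {c})"
  shows "connected_on w (D - M)"
proof (rule connected_onI[of c])
  have MD: "M \<subseteq> D - {c}" "eb M (D - {c} - M) = 0" using M by (auto simp: component_of_def)
  show "c \<in> D - M" using MD assms by auto
  fix A assume A: "A \<subseteq> D - M" "A \<noteq> {}" "c \<notin> A"
  have "0 < eb A (D - A)" using A assms unfolding connected_on_def by blast
  moreover have "eb A M \<le> eb (D - {c} - M) M" using A assms MD
    by (intro eb_mono) (auto intro: finite_subset)
  then have "eb A M = 0" using MD eb_sym by (metis le_zero_eq)
  moreover have "eb A (D - A) = eb A M + eb A (D - M - A)"
  proof -
    have "D - A - M = D - M - A" "M \<subseteq> D - A" using A MD by auto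
    then show ?thesis using eb_split_right[of "D - A" M w A] assms by simp
  qed
  ultimately show "0 < eb A (D - M - A)" by simp
qed

text \<open>The component of \<open>D - {c}\<close> at the front end is again a corridor, with \<open>c\<close> behind it. A passage through
  this component that avoids some vertex \<open>a\<close> next to \<open>K\<close> would extend, through \<open>c\<close> and the rest of \<open>D\<close>,
  to a passage through \<open>D\<close> that avoids \<open>a\<close>.\<close>
lemma corridor_part:
  assumes D: "corridor k D p q" and c: "c \<in> D" "0 < k c"
    and M: "component_of w M (D - {c})" and pM: "sum p M = 1"
  shows "corridor k M p (w c)"
proof -
  have fin: "finite D" and conn: "connected_on w D" and sums: "sum p D = 1" "sum q D = 1"
    and cut: "\<And>S. S \<subseteq> D \<Longrightarrow> S \<noteq> {} \<Longrightarrow> 3 \<le> sum p S + sum q S + sum k S + eb S (D - S)"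
    and deg: "\<And>c. c \<in> D \<Longrightarrow> 0 < k c \<Longrightarrow> p c + q c + k c + eb {c} D \<le> 3"
    and sep: "\<And>c S. c \<in> D \<Longrightarrow> 0 < k c \<Longrightarrow> S \<subseteq> D - {c} \<Longrightarrow> connected_on w S \<Longrightarrow> sum p S = 0 \<or> sum q S = 0"
    using D by (auto simp: corridor_def)
  have MD: "M \<subseteq> D - {c}" "M \<noteq> {}" "connected_on w M" "eb M (D - {c} - M) = 0"
    using M by (auto simp: component_of_def)
  have finM: "finite M" using MD fin by (auto intro: finite_subset)
  have qM: "sum q M = 0" using corridor_cut(2)[OF D c M] pM by simp
  then have q0: "sum q S = 0" if "S \<subseteq> M" for S using that finM
    by (metis le_zero_eq sum_mono2 zero_le)
  have out: "eb S (D - S) = eb S (M - S) + sum (w c) S" if S: "S \<subseteq> M" for S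
  proof -
    have "eb S (D - {c} - M) \<le> eb M (D - {c} - M)" using S finM fin by (intro eb_mono) auto
    then have 0: "eb S (D - {c} - M) = 0" using MD by simp
    have "eb S (D - S) = eb S {c} + eb S (D - S - {c})"
      using eb_split_right[of "D - S" "{c}" w S] fin c S MD by auto
    moreover have "eb S (D - S - {c}) = eb S (M - S) + eb S (D - S - {c} - (M - S))"
      using S MD fin by (intro eb_split_right) auto
    moreover have "D - S - {c} - (M - S) = D - {c} - M" using S by auto
    ultimately show ?thesis using 0 by (simp add: eb_singleton sym)
  qed
  show ?thesis unfolding corridor_def
  proof (intro conjI allI ballI impI)
    show "finite M" "connected_on w M" "sum p M = 1" by fact+
    show "sum (w c) M = 1" using corridor_cut(3)[OF D c M] by (simp add: eb_singleton sym)
  next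
    fix S assume S: "S \<subseteq> M" "S \<noteq> {}"
    then have "3 \<le> sum p S + sum q S + sum k S + eb S (D - S)" using MD by (intro cut) auto
    then show "3 \<le> sum p S + sum (w c) S + sum k S + eb S (M - S)" using out q0 S by simp
  next
    fix a assume a: "a \<in> M" "0 < k a"
    have "eb {a} D = eb {a} (D - {a})" using eb_split_right[of D "{a}" w "{a}"] fin a MD
      by (auto simp: eb_singleton)
    moreover have "eb {a} M = eb {a} (M - {a})" using eb_split_right[of M "{a}" w "{a}"] finM a
      by (auto simp: eb_singleton)
    moreover have "p a + q a + k a + eb {a} D \<le> 3" using deg a MD by blast
    moreover have "eb {a} (D - {a}) = eb {a} (M - {a}) + w c a" using out[of "{a}"] a by simp
    ultimately show "p a + w c a + k a + eb {a} M \<le> 3" by linarith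
  next
    fix a S assume a: "a \<in> M" "0 < k a" and S: "S \<subseteq> M - {a}" "connected_on w S"
    show "sum p S = 0 \<or> sum (w c) S = 0"
    proof (rule ccontr)
      assume neg: "\<not> ?thesis"
      then obtain b where b: "b \<in> S" "0 < w c b" by (metis not_gr_zero sum.neutral)
      let ?T = "S \<union> (D - M)"
      have finS: "finite S" using S finM finite_subset by blast
      have "connected_on w ?T"
        using connected_on_Un[OF finS _ S(2) connected_on_minus_component[OF fin conn c(1) M], of b c]
          b fin c MD sym by auto
      then have "sum p ?T = 0 \<or> sum q ?T = 0" using a S MD by (intro sep[of a]) auto
      moreover have "sum p S \<le> sum p ?T" "sum q (D - M) \<le> sum q ?T"
        using fin finS by (auto intro!: sum_mono2)
      moreover have "sum q (D - M) = 1"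
        using sum.subset_diff[of M D q] qM subset_trans[OF MD(1)] sums fin by simp
      ultimately show False using neg by auto
    qed
  qed
qed

lemma corridor_side:
  assumes D: "corridor k D p q" and c: "c \<in> D" "0 < k c"
  obtains "p c = 1" | M where "p c = 0" "component_of w M (D - {c})" "sum p M = 1" "corridor k M p (w c)"
proof (cases "p c = 0")
  case True
  have fin: "finite D" and pD: "sum p D = 1" using D by (auto simp: corridor_def)
  have "sum p (D - {c}) = 1" using sum.remove[OF fin c(1), of p] pD True by simp
  then obtain x where x: "x \<in> D - {c}" "0 < p x" by (metis not_gr_zero sum.neutral zero_neq_one)
  then obtain M where M: "component_of w M (D - {c})" "x \<in> M" using component_exists fin by (metis finite_Diff)
  have "finite M" using M fin finite_subset unfolding component_of_def by blast
  then have "0 < sum p M" using x M(2) by (meson member_le_sum order_less_le_trans zero_le)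
  then have "sum p M = 1" using corridor_cut(2)[OF D c M(1)] by simp
  then show thesis using that(2)[OF True M(1)] corridor_part[OF D c M(1)] by blast
next
  case False
  have "finite D" "sum p D = 1" using D by (auto simp: corridor_def)
  then have "p c \<le> 1" using c by (metis member_le_sum zero_le)
  then show thesis using that(1) False by simp
qed

text \<open>The list \<open>L\<close> is a path that uses every edge inside \<open>D\<close>, starting at the front end and
  finishing at the rear end, and each of its vertices has one edge to \<open>K\<close>.\<close>
definition traces :: "('a \<Rightarrow> nat) \<Rightarrow> 'a set \<Rightarrow> ('a \<Rightarrow> nat) \<Rightarrow> ('a \<Rightarrow> nat) \<Rightarrow> 'a list \<Rightarrow> bool" where
  "traces k D p q L \<longleftrightarrow> distinct L \<and> set L = D \<and> (\<forall>v\<in>D. k v = 1) \<and>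
     (\<forall>v\<in>D. p v = of_bool (v = hd L)) \<and> (\<forall>v\<in>D. q v = of_bool (v = last L)) \<and>
     (\<forall>u\<in>D. \<forall>v\<in>D. w u v = count (path_edges L) {u, v})"

text \<open>Some vertex \<open>c\<close> of the corridor is next to \<open>K\<close>, since otherwise the corridor would be left by two edges
  only. Splitting at \<open>c\<close> gives a corridor or nothing on each side, and the two paths are joined at \<open>c\<close>.\<close>
lemma corridor_is_path:
  assumes "corridor k D p q"
  shows "\<exists>L. traces k D p q L"
  using assms
proof (induction "card D" arbitrary: D p q rule: less_induct)
  case less
  note D = less.prems
  have fin: "finite D" and sums: "sum p D = 1" "sum q D = 1"
    and cut: "\<And>S. S \<subseteq> D \<Longrightarrow> S \<noteq> {} \<Longrightarrow> 3 \<le> sum p S + sum q S + sum k S + eb S (D - S)"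
    using D by (auto simp: corridor_def)
  have "D \<noteq> {}" using sums by auto
  then have "0 < sum k D" using cut[of D] sums by simp
  then obtain c where c: "c \<in> D" "0 < k c" by (metis not_gr_zero sum.neutral)
  note cut_c = corridor_cut[OF D c]
  have IH: "\<exists>L. traces k M p' q' L" if "component_of w M (D - {c})" "corridor k M p' q'" for M p' q'
  proof (rule less.hyps)
    have "M \<subseteq> D - {c}" using that by (auto simp: component_of_def)
    then show "card M < card D" using fin c by (intro psubset_card_mono) auto
  qed fact
  have side: "\<exists>M. (\<exists>L. traces k M p' (w c) L) \<and> (\<exists>L. traces k M (w c) p' L) \<and>
      sum p' (D - {c} - M) = 0 \<and>
      (M = {} \<and> p' c = 1 \<or> p' c = 0 \<and> component_of w M (D - {c}) \<and> sum p' M = 1)"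
    if D': "corridor k D p' q'" for p' q'
    using D' c
  proof (cases rule: corridor_side)
    case 1
    have "sum p' D = 1" using D' by (simp add: corridor_def)
    then have "sum p' (D - {c}) = 0" using sum.remove[OF fin c(1), of p'] 1 by simp
    then show ?thesis using 1 by (intro exI[of _ "{}"]) (auto simp: traces_def)
  next
    case (2 M)
    have sub: "M \<subseteq> D - {c}" using 2 by (auto simp: component_of_def)
    have "sum p' D = 1" using D' by (simp add: corridor_def)
    then have "sum p' (D - {c} - M) = 0"
      using sum.remove[OF fin c(1), of p'] sum.subset_diff[OF sub, of p'] 2 fin by simp
    then show ?thesis using IH 2 corridor_sym by blast
  qed
  obtain P Lp where P: "traces k P p (w c) Lp" "sum p (D - {c} - P) = 0"
    and P_cases: "P = {} \<and> p c = 1 \<or> p c = 0 \<and> component_of w P (D - {c}) \<and> sum p P = 1"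
    using side[OF D] by blast
  obtain Q Lq where Q: "traces k Q (w c) q Lq" "sum q (D - {c} - Q) = 0"
    and Q_cases: "Q = {} \<and> q c = 1 \<or> q c = 0 \<and> component_of w Q (D - {c}) \<and> sum q Q = 1"
    using side[OF corridor_sym[OF D]] by blast
  have sub: "P \<subseteq> D - {c}" "Q \<subseteq> D - {c}" using P_cases Q_cases by (auto simp: component_of_def)
  have disj: "P \<inter> Q = {}"
  proof (rule ccontr)
    assume *: "P \<inter> Q \<noteq> {}"
    then have comps: "component_of w P (D - {c})" "component_of w Q (D - {c})" "sum p P = 1" "sum q Q = 1"
      using P_cases Q_cases by auto
    have "P \<subseteq> Q" "Q \<subseteq> P"
      using component_absorbs[of "D - {c}"] comps fin * sub unfolding component_of_def by (metis finite_Diff Int_commute)+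
    then have "P = Q" by auto
    then show False using cut_c(2)[OF comps(1)] comps by simp
  qed
  have cover: "D = P \<union> {c} \<union> Q"
  proof (rule ccontr)
    assume "D \<noteq> P \<union> {c} \<union> Q"
    then obtain v where v: "v \<in> D - {c}" "v \<notin> P" "v \<notin> Q" using sub c by auto
    obtain N where N: "component_of w N (D - {c})" "v \<in> N" using component_exists fin v by (metis finite_Diff)
    have Nsub: "N \<subseteq> D - {c}" using N by (simp add: component_of_def)
    have "N \<inter> P = {}" using component_absorbs[of "D - {c}" P N] P_cases N v fin
      by (auto simp: component_of_def)
    moreover have "N \<inter> Q = {}" using component_absorbs[of "D - {c}" Q N] Q_cases N v fin
      by (auto simp: component_of_def)
    ultimately have "N \<subseteq> D - {c} - P" "N \<subseteq> D - {c} - Q" using Nsub by auto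
    then have "sum p N = 0" "sum q N = 0"
      using P(2) Q(2) fin by (metis finite_Diff le_zero_eq sum_mono2 zero_le)+
    then show False using cut_c(2)[OF N(1)] by simp
  qed
  have wPQ: "w u v = 0" if "u \<in> P" "v \<in> Q" for u v
  proof (rule ccontr)
    assume "w u v \<noteq> 0"
    moreover have "v \<in> D - {c} - P" using that sub disj by auto
    moreover have "finite P" "finite (D - {c} - P)" using fin sub by (auto intro: finite_subset)
    ultimately have "0 < eb P (D - {c} - P)" using that(1) by (subst eb_pos_iff) auto
    then show False using that P_cases by (auto simp: component_of_def)
  qed
  have p0: "p v = 0" if "v \<in> Q" for v
    using P(2) that sub disj fin by auto
  have q0: "q v = 0" if "v \<in> P" for v
    using Q(2) that sub disj fin by auto
  let ?L = "Lp @ c # Lq"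
  have setP: "set Lp = P" "distinct Lp" and setQ: "set Lq = Q" "distinct Lq"
    using P Q by (auto simp: traces_def)
  have emptyP: "Lp = [] \<longleftrightarrow> P = {}" and emptyQ: "Lq = [] \<longleftrightarrow> Q = {}" using setP setQ by auto
  have cnt: "count (path_edges ?L) {u, v} = count (path_edges Lp) {u, v} + count (path_edges Lq) {u, v}
      + of_bool (Lp \<noteq> [] \<and> {u, v} = {last Lp, c}) + of_bool (Lq \<noteq> [] \<and> {u, v} = {c, hd Lq})" for u v
    by (subst path_edges_append) (simp add: count_path_edges_snoc count_path_edges_Cons)
  have lastP: "Lp \<noteq> [] \<Longrightarrow> last Lp \<in> P" and hdP: "Lp \<noteq> [] \<Longrightarrow> hd Lp \<in> P"
    and lastQ: "Lq \<noteq> [] \<Longrightarrow> last Lq \<in> Q" and hdQ: "Lq \<noteq> [] \<Longrightarrow> hd Lq \<in> Q" using setP setQ by auto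
  have cnotin: "c \<notin> P" "c \<notin> Q" using sub by auto
  have "traces k D p q ?L" unfolding traces_def
  proof (intro conjI ballI)
    show "distinct ?L" "set ?L = D" using setP setQ cnotin disj cover by auto
    fix v assume v: "v \<in> D"
    show "k v = 1" using v P Q cut_c(1) cover by (auto simp: traces_def)
    show "p v = of_bool (v = hd ?L)"
    proof (cases "P = {}")
      case True then show ?thesis using v cover p0 P_cases emptyP cnotin by (auto simp: component_of_def)
    next
      case False then show ?thesis using v cover p0 P P_cases emptyP hdP cnotin disj by (auto simp: traces_def hd_append)
    qed
    show "q v = of_bool (v = last ?L)"
    proof (cases "Q = {}")
      case True then show ?thesis using v cover q0 Q_cases emptyQ cnotin by (auto simp: component_of_def)
    next
      case False then show ?thesis using v cover q0 Q Q_cases emptyQ lastQ cnotin disj by (auto simp: traces_def)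
    qed
  next
    have wcP: "w c v = of_bool (v = last Lp)" if "v \<in> P" for v using P that by (simp add: traces_def)
    have wcQ: "w c v = of_bool (v = hd Lq)" if "v \<in> Q" for v using Q that by (simp add: traces_def)
    have symcnt: "count (path_edges L) {u, v} = count (path_edges L) {v, u}" for L and u v :: 'a
      by (simp add: insert_commute)
    have half: "w u v = count (path_edges ?L) {u, v}"
      if uv: "u \<in> P \<and> v \<in> P \<or> u \<in> P \<and> v \<in> Q \<or> u \<in> Q \<and> v \<in> Q \<or> u = c" "v \<in> D" for u v
    proof -
      consider "u \<in> P" "v \<in> P" | "u \<in> P" "v \<in> Q" | "u \<in> Q" "v \<in> Q" | "u = c" "v = c" | "u = c" "v \<in> P" | "u = c" "v \<in> Q"
        using uv cover by blast
      then show ?thesis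
      proof cases
        case 1
        then have "w u v = count (path_edges Lp) {u, v}" using P by (simp add: traces_def)
        moreover have "u \<notin> set Lq" using 1 setQ disj by auto
        ultimately show ?thesis unfolding cnt using 1 cnotin
          by (auto simp: count_path_edges_notin doubleton_eq_iff)
      next
        case 2
        then have "u \<notin> set Lq" "v \<notin> set Lp" using setP setQ disj by auto
        then show ?thesis unfolding cnt using 2 cnotin wPQ
          by (auto simp: count_path_edges_notin doubleton_eq_iff)
      next
        case 3
        then have "w u v = count (path_edges Lq) {u, v}" using Q by (simp add: traces_def)
        moreover have "u \<notin> set Lp" using 3 setP disj by auto
        ultimately show ?thesis unfolding cnt using 3 cnotin
          by (auto simp: count_path_edges_notin doubleton_eq_iff)
      next
        case 4
        then show ?thesis unfolding cnt using cnotin setP setQ lastP hdQ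
          by (auto simp: count_path_edges_notin[of c Lp c, simplified] count_path_edges_notin[of c Lq c, simplified])
      next
        case 5
        then have "Lp \<noteq> []" using emptyP by auto
        then show ?thesis unfolding cnt using 5 cnotin setP setQ hdQ disj wcP[of v]
          by (auto simp: count_path_edges_notin doubleton_eq_iff)
      next
        case 6
        then have "Lq \<noteq> []" using emptyQ by auto
        then show ?thesis unfolding cnt using 6 cnotin setP setQ lastP disj wcQ[of v]
          by (auto simp: count_path_edges_notin doubleton_eq_iff)
      qed
    qed
    fix u v assume "u \<in> D" "v \<in> D"
    then show "w u v = count (path_edges ?L) {u, v}"
      using half[of u v] half[of v u] cover sym[of u v] symcnt[of ?L u v] by auto
  qed
  then show ?case by blast
qed

end

section \<open>A contractible cycle\<close>

definition exact_cuts :: "nat \<Rightarrow> 'a set \<Rightarrow> ('a \<Rightarrow> 'a \<Rightarrow> nat) \<Rightarrow> bool" where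
  "exact_cuts k V w \<longleftrightarrow>
     (\<forall>A. A \<subseteq> V \<longrightarrow> A \<noteq> {} \<longrightarrow> A \<noteq> V \<longrightarrow> k \<le> edges_between w A (V - A)) \<and>
     (\<forall>x\<in>V. \<forall>y\<in>V. x \<noteq> y \<longrightarrow> (\<exists>A. A \<subseteq> V \<and> x \<in> A \<and> y \<notin> A \<and> edges_between w A (V - A) = k))"

locale exactly_three_connected = multiplicity w for w :: "'a \<Rightarrow> 'a \<Rightarrow> nat" +
  fixes V :: "'a set"
  assumes finite_V: "finite V" and exact: "exact_cuts 3 V w"
begin

abbreviation cut where "cut A \<equiv> eb A (V - A)"

definition tight where "tight A \<longleftrightarrow> A \<subseteq> V \<and> A \<noteq> {} \<and> A \<noteq> V \<and> cut A = 3"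

lemma fin: "A \<subseteq> V \<Longrightarrow> finite A"
  using finite_V finite_subset by blast

lemma cut_ge: "A \<subseteq> V \<Longrightarrow> A \<noteq> {} \<Longrightarrow> A \<noteq> V \<Longrightarrow> 3 \<le> cut A"
  using exact unfolding exact_cuts_def by blast

lemma separating: "x \<in> V \<Longrightarrow> y \<in> V \<Longrightarrow> x \<noteq> y \<Longrightarrow> \<exists>A. tight A \<and> x \<in> A \<and> y \<notin> A"
  using exact unfolding exact_cuts_def tight_def by blast

lemma cut_compl: "A \<subseteq> V \<Longrightarrow> cut (V - A) = cut A"
  by (simp add: double_diff eb_sym)

lemma tight_compl: "tight A \<Longrightarrow> tight (V - A)"
  using cut_compl unfolding tight_def by auto

lemma odd_triangle: "a + b = 3 \<Longrightarrow> a + c = 3 \<Longrightarrow> b + c = 3 \<Longrightarrow> False" for a b c :: nat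
  by presburger

text \<open>If two tight sets crossed, submodularity would make all four corners tight with no edges between
  opposite corners. Then three of the remaining edge counts would add up pairwise to three, so
  twice their sum would be nine.\<close>
lemma tight_uncross:
  assumes "tight A" "tight B"
  shows "A \<subseteq> B \<or> B \<subseteq> A \<or> A \<inter> B = {} \<or> A \<union> B = V"
proof (rule ccontr)
  assume neg: "\<not> ?thesis"
  have AB: "A \<subseteq> V" "B \<subseteq> V" "cut A = 3" "cut B = 3" using assms by (auto simp: tight_def)
  define P where "P = A \<inter> B"
  define Q where "Q = A - B"
  define R where "R = B - A"
  define S where "S = V - (A \<union> B)"
  note defs = P_def Q_def R_def S_def
  have f: "finite P" "finite Q" "finite R" "finite S"
    using AB by (auto simp: defs intro: fin finite_subset[OF _ finite_V])
  have disj: "P \<inter> Q = {}" "P \<inter> R = {}" "P \<inter> S = {}" "Q \<inter> R = {}" "Q \<inter> S = {}" "R \<inter> S = {}"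
    by (auto simp: defs)
  have ne: "P \<noteq> {}" "Q \<noteq> {}" "R \<noteq> {}" "S \<noteq> {}" using neg AB by (auto simp: defs)
  have sets: "A = P \<union> Q" "V - A = R \<union> S" "B = P \<union> R" "V - B = Q \<union> S"
    using AB by (auto simp: defs)
  have corner: "V - P = Q \<union> (R \<union> S)" "V - Q = P \<union> (R \<union> S)" "V - R = P \<union> (Q \<union> S)" "V - S = P \<union> (Q \<union> R)"
    using AB by (auto simp: defs)
  have sub: "P \<subseteq> V" "Q \<subseteq> V" "R \<subseteq> V" "S \<subseteq> V" using AB by (auto simp: defs)
  have "P \<noteq> V" "Q \<noteq> V" "R \<noteq> V" "S \<noteq> V" using ne disj sub by auto
  then have ge: "3 \<le> cut P" "3 \<le> cut Q" "3 \<le> cut R" "3 \<le> cut S" using ne sub cut_ge by auto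
  have a: "cut A = eb P R + eb P S + eb Q R + eb Q S"
    using f disj unfolding sets(2) unfolding sets(1) by (simp add: eb_Un_left eb_Un_right)
  have b: "cut B = eb P Q + eb P S + eb Q R + eb R S"
    using f disj unfolding sets(4) unfolding sets(3) by (simp add: eb_Un_left eb_Un_right eb_sym[of R Q])
  have "cut P = eb P Q + eb P R + eb P S"
    using f disj unfolding corner by (simp add: eb_Un_right Int_Un_distrib)
  moreover have "cut Q = eb P Q + eb Q R + eb Q S"
    using f disj unfolding corner by (simp add: eb_Un_right Int_Un_distrib eb_sym[of Q P])
  moreover have "cut R = eb P R + eb Q R + eb R S"
    using f disj unfolding corner by (simp add: eb_Un_right Int_Un_distrib eb_sym[of R P] eb_sym[of R Q])
  moreover have "cut S = eb P S + eb Q S + eb R S"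
    using f disj unfolding corner by (simp add: eb_Un_right Int_Un_distrib eb_sym[of S P] eb_sym[of S Q] eb_sym[of S R])
  ultimately have "eb P S = 0" "eb Q R = 0" "eb P Q + eb P R = 3" "eb P Q + eb Q S = 3" "eb P R + eb Q S = 3"
    using a b ge AB by linarith+
  then show False using odd_triangle by blast
qed

text \<open>A tight set that separates two vertices of \<open>A\<close> does not cross \<open>A\<close>, so it or its complement lies inside
  \<open>A\<close>.\<close>
lemma tight_split:
  assumes A: "tight A" and xy: "x \<in> A" "y \<in> A" "x \<noteq> y"
  shows "\<exists>B. tight B \<and> B \<subset> A \<and> (x \<in> B) \<noteq> (y \<in> B)"
proof -
  have "A \<subseteq> V" using A by (simp add: tight_def)
  then obtain B where B: "tight B" "x \<in> B" "y \<notin> B" using separating xy by blast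
  then have "B \<subseteq> V" by (simp add: tight_def)
  then consider "B \<subset> A" | "A \<union> B = V" using tight_uncross[OF A B(1)] B xy by blast
  then show ?thesis
  proof cases
    case 2
    then have "V - B \<subset> A" using B xy by blast
    then show ?thesis using tight_compl[OF B(1)] B xy \<open>A \<subseteq> V\<close> by (intro exI[of _ "V - B"]) auto
  qed (use B in blast)
qed

text \<open>Two parts of a tight set without edges between them would need three outgoing edges each.\<close>
lemma tight_connected:
  assumes A: "tight A"
  shows "connected_on w A"
  unfolding connected_on_def
proof (intro allI impI, rule ccontr)
  fix B assume B: "B \<subseteq> A" "B \<noteq> {}" "B \<noteq> A" and zero: "\<not> 0 < eb B (A - B)"
  have AV: "A \<subseteq> V" "A \<noteq> V" "cut A = 3" using A by (auto simp: tight_def)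
  have f: "finite A" "finite B" using AV B fin by auto
  have sets: "V - B = (A - B) \<union> (V - A)" "V - (A - B) = B \<union> (V - A)" "A = B \<union> (A - B)"
    using AV B by auto
  have "cut B = eb B (V - A)" unfolding sets(1)
    using zero f finite_V by (subst eb_Un_right) auto
  moreover have "cut (A - B) = eb (A - B) (V - A)" unfolding sets(2)
    using zero f finite_V AV B by (subst eb_Un_right) (auto simp: eb_sym[of "A - B" B])
  moreover have "eb A (V - A) = eb B (V - A) + eb (A - B) (V - A)"
    using eb_split_left[OF f(1) B(1)] .
  moreover have "3 \<le> cut B" "3 \<le> cut (A - B)" using AV B by (auto intro!: cut_ge)
  ultimately show False using AV by linarith
qed

lemma tight_singleton_exists:
  assumes "2 \<le> card V"
  shows "\<exists>v. tight {v}"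
proof -
  obtain x y where "x \<in> V" "y \<in> V" "x \<noteq> y"
    using assms card_le_Suc0_iff_eq[OF finite_V] by fastforce
  then obtain A0 where "tight A0" using separating by blast
  then obtain A where A: "tight A" and min: "\<And>B. tight B \<Longrightarrow> card A \<le> card B"
    using ex_has_least_nat[of tight A0 card] by blast
  have fA: "finite A" "A \<noteq> {}" using A fin by (auto simp: tight_def)
  have "x = y" if xy: "x \<in> A" "y \<in> A" for x y
  proof (rule ccontr)
    assume "x \<noteq> y"
    then obtain B where B: "tight B" "B \<subset> A" using tight_split[OF A xy] by blast
    show False using min[OF B(1)] psubset_card_mono[OF fA(1) B(2)] by simp
  qed
  then obtain v where "A = {v}" using fA by auto
  then show ?thesis using A by auto
qed

text \<open>The set \<open>X\<close> is a minimal tight set among those with at least two vertices. By \<open>tight_split\<close> two of its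
  vertices are separated by a smaller tight set, which must be a singleton, so at most one vertex of
  \<open>X\<close> fails to form a tight singleton.\<close>
lemma almost_cubic_side:
  assumes "3 \<le> card V"
  obtains X s where "tight X" "2 \<le> card X" "s \<in> X" "\<And>x. x \<in> X \<Longrightarrow> x \<noteq> s \<Longrightarrow> tight {x}"
proof -
  obtain v where v: "tight {v}" using tight_singleton_exists assms by auto
  define P where "P X \<longleftrightarrow> tight X \<and> 2 \<le> card X" for X
  have "P (V - {v})" using tight_compl[OF v] v assms finite_V by (auto simp: P_def tight_def card_Diff_singleton)
  then obtain X where X: "P X" and min: "\<And>B. P B \<Longrightarrow> card X \<le> card B"
    using ex_has_least_nat[of P "V - {v}" card] by blast
  have fX: "finite X" "X \<noteq> {}" using X fin by (auto simp: P_def tight_def)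
  have one: "tight {x} \<or> tight {y}" if xy: "x \<in> X" "y \<in> X" "x \<noteq> y" for x y
  proof -
    obtain B where B: "tight B" "B \<subset> X" "(x \<in> B) \<noteq> (y \<in> B)"
      using tight_split X xy unfolding P_def by blast
    have "card B < card X" using psubset_card_mono[OF fX(1) B(2)] .
    then have "\<not> 2 \<le> card B" using min[of B] B by (auto simp: P_def)
    moreover have "card B \<noteq> 0" using B fX finite_subset[of B X] by (auto simp: tight_def)
    ultimately obtain b where "B = {b}" using card_1_singletonE[of B] by (metis less_2_cases not_less One_nat_def)
    then show ?thesis using B by auto
  qed
  obtain s where "s \<in> X" "\<And>x. x \<in> X \<Longrightarrow> x \<noteq> s \<Longrightarrow> tight {x}"
  proof (cases "\<exists>s\<in>X. \<not> tight {s}")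
    case True then show thesis using one that by blast
  next
    case False then show thesis using fX that by blast
  qed
  then show thesis using that X by (auto simp: P_def)
qed

text \<open>A connected set that avoids \<open>s\<close> and has two edges to \<open>s\<close> stands for a cycle through \<open>s\<close>. If no component
  of \<open>X - {s}\<close> had two edges to \<open>s\<close>, each would need two edges to leave \<open>X\<close>. With two components that is more
  than the three edges that leave \<open>X\<close>; with one component, \<open>s\<close> needs two such edges as well.\<close>
lemma cycle_through:
  assumes X: "tight X" "2 \<le> card X" and s: "s \<in> X"
  shows "\<exists>Z \<subseteq> X - {s}. connected_on w Z \<and> 2 \<le> eb {s} Z"
proof (rule ccontr)
  assume "\<not> ?thesis"
  then have neg: "eb {s} Z \<le> 1" if "Z \<subseteq> X - {s}" "connected_on w Z" for Z
    using that by (metis less_eq_Suc_le not_less numeral_2_eq_2 One_nat_def)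
  have XV: "X \<subseteq> V" "X \<noteq> V" "cut X = 3" using X by (auto simp: tight_def)
  have fX: "finite X" using fin XV by auto
  have comp: "2 \<le> eb Z (V - X)" if Z: "component_of w Z (X - {s})" for Z
  proof -
    have ZX: "Z \<subseteq> X - {s}" "Z \<noteq> {}" "connected_on w Z" "eb Z (X - {s} - Z) = 0"
      using Z by (auto simp: component_of_def)
    have "V - Z = {s} \<union> ((X - {s} - Z) \<union> (V - X))" using ZX XV s by auto
    then have "cut Z = eb Z {s} + (eb Z (X - {s} - Z) + eb Z (V - X))"
      using fX finite_V s by (simp only:) (subst eb_Un_right, auto)+
    moreover have "3 \<le> cut Z" using ZX XV by (intro cut_ge) auto
    ultimately show ?thesis using neg[OF ZX(1,3)] ZX eb_sym[of Z "{s}"] by simp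
  qed
  have "card (X - {s}) \<noteq> 0" using X(2) s fX by simp
  then have "X - {s} \<noteq> {}" by (metis card.empty)
  then obtain x where "x \<in> X - {s}" by auto
  then obtain Z where Z: "component_of w Z (X - {s})" using component_exists fX by (metis finite_Diff)
  have ZX: "Z \<subseteq> X - {s}" "connected_on w Z" using Z by (auto simp: component_of_def)
  show False
  proof (cases "X - {s} - Z = {}")
    case True
    then have eqs: "X - {s} = Z" using ZX by auto
    have "V - {s} = Z \<union> (V - X)" using eqs XV s by auto
    then have "cut {s} = eb {s} Z + eb {s} (V - X)"
      using ZX fX finite_V by (simp only:) (subst eb_Un_right, auto intro: finite_subset)
    moreover have "3 \<le> cut {s}" using XV s by (intro cut_ge) auto
    moreover have "eb X (V - X) = eb {s} (V - X) + eb Z (V - X)"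
      using eb_split_left[of X "{s}" w "V - X"] fX s eqs by simp
    ultimately show False using neg[OF ZX] comp[OF Z] XV by linarith
  next
    case False
    then obtain y where "y \<in> X - {s} - Z" by auto
    then obtain Z' where Z': "component_of w Z' (X - {s} - Z)" using component_exists fX by (metis finite_Diff)
    then have "2 \<le> eb Z' (V - X)" using comp component_of_remainder[OF _ Z] fX by blast
    moreover have "eb X (V - X) = eb Z (V - X) + eb (X - Z) (V - X)"
      using eb_split_left[of X Z w "V - X"] fX ZX by blast
    moreover have "eb Z' (V - X) \<le> eb (X - Z) (V - X)"
      using Z' fX finite_V by (intro eb_mono) (auto simp: component_of_def)
    ultimately show False using comp[OF Z] XV by linarith
  qed
qed

text \<open>The cycle consists of \<open>s\<close> and the path \<open>L\<close>, and \<open>K\<close> is everything else. The last two conclusions provide the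
  tight sets that separate two vertices after the cycle has been contracted: they lie inside \<open>K\<close>, so they
  are not affected by the contraction.\<close>
lemma contractible_cycle:
  assumes card_V: "3 \<le> card V" and biconn: "\<And>v. v \<in> V \<Longrightarrow> connected_on w (V - {v})"
  obtains K s L where
    "V = K \<union> insert s (set L)" "K \<inter> insert s (set L) = {}" "s \<notin> set L" "distinct L" "L \<noteq> []" "K \<noteq> {}"
    "connected_on w K"
    "\<forall>u\<in>set L. \<forall>v\<in>set L. w u v = count (path_edges L) {u, v}"
    "\<forall>v\<in>set L. w s v = of_bool (v = hd L) + of_bool (v = last L)"
    "\<forall>v\<in>set L. eb {v} K = 1" "1 \<le> eb {s} K"
    "\<forall>x\<in>K. \<exists>A \<subseteq> K. x \<in> A \<and> cut A = 3"
    "\<forall>x\<in>K. \<forall>y\<in>K. x \<noteq> y \<longrightarrow> (\<exists>A \<subseteq> K. cut A = 3 \<and> (x \<in> A) \<noteq> (y \<in> A))"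
proof -
  obtain X s where X: "tight X" "2 \<le> card X" and s: "s \<in> X"
    and cubic: "\<And>x. x \<in> X \<Longrightarrow> x \<noteq> s \<Longrightarrow> tight {x}" using almost_cubic_side card_V by blast
  have XV: "X \<subseteq> V" "X \<noteq> V" "cut X = 3" using X by (auto simp: tight_def)
  have sV: "s \<in> V" using s XV by auto
  define P where "P K \<longleftrightarrow> V - X \<subseteq> K \<and> K \<subseteq> V - {s} \<and> connected_on w K \<and>
      (\<exists>Z \<subseteq> V - K - {s}. connected_on w Z \<and> 2 \<le> eb {s} Z)" for K
  have "P (V - X)"
    using cycle_through[OF X s] tight_connected[OF tight_compl[OF X(1)]] s XV
    by (auto simp: P_def double_diff)
  moreover have "\<forall>K. P K \<longrightarrow> card K < Suc (card V)"
    using finite_V by (auto simp: P_def less_Suc_eq_le intro: card_mono)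
  ultimately have "\<exists>K. P K \<and> (\<forall>K'. P K' \<longrightarrow> card K' \<le> card K)"
    by (rule ex_has_greatest_nat)
  then obtain K where K: "P K" and max: "\<And>K'. P K' \<Longrightarrow> card K' \<le> card K" by metis
  have KV: "V - X \<subseteq> K" "K \<subseteq> V - {s}" "connected_on w K" and fK: "finite K"
    using K fin[of K] by (auto simp: P_def)
  have K_ne: "K \<noteq> {}" using KV XV by auto
  define R where "R = V - K - {s}"
  have fR: "finite R" by (simp add: R_def finite_V)
  \<comment> \<open>A neighbour \<open>c\<close> of \<open>K\<close> lies on every cycle through \<open>s\<close> outside \<open>K\<close>, or it could be added to \<open>K\<close>.\<close>
  have barrier: "eb {s} S \<le> 1"
    if c: "c \<in> R" "0 < eb {c} K" and S: "S \<subseteq> R - {c}" "connected_on w S" for c S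
  proof (rule ccontr)
    assume "\<not> eb {s} S \<le> 1"
    moreover obtain a where "a \<in> K" "0 < w a c"
      using c fK sym by (subst (asm) eb_pos_iff) auto
    then have "connected_on w (insert c K)" using connected_on_insert KV fK by blast
    moreover have "S \<subseteq> V - insert c K - {s}" using S by (auto simp: R_def)
    ultimately have "P (insert c K)" using KV c S by (auto simp: P_def R_def intro!: exI[of _ S])
    then have "card (insert c K) \<le> card K" by (rule max)
    then show False using fK c by (auto simp: R_def)
  qed
  obtain Z0 where Z0: "Z0 \<subseteq> R" "connected_on w Z0" "2 \<le> eb {s} Z0" using K by (auto simp: P_def R_def)
  then obtain z where z: "z \<in> Z0" by fastforce
  obtain Z where Z: "component_of w Z R" "z \<in> Z" using component_exists fR z Z0 by blast
  have ZR: "Z \<subseteq> R" "connected_on w Z" "eb Z (R - Z) = 0" using Z by (auto simp: component_of_def)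
  have "Z0 \<subseteq> Z" using component_absorbs[OF fR Z(1) Z0(2,1)] z Z(2) by blast
  then have sZ: "2 \<le> eb {s} Z"
    using Z0(3) eb_mono[of "{s}" Z "{s}" Z0 w] ZR fR finite_subset by fastforce
  \<comment> \<open>Other components have a neighbour in \<open>K\<close>, as \<open>s\<close> is no articulation point; moving it to \<open>K\<close> spares \<open>Z\<close>.\<close>
  have RZ: "R = Z"
  proof (rule ccontr)
    assume "R \<noteq> Z"
    let ?W = "R - Z"
    have W: "?W \<noteq> {}" "?W \<subseteq> V - {s}" "?W \<noteq> V - {s}" using \<open>R \<noteq> Z\<close> ZR K_ne KV by (auto simp: R_def)
    then have "0 < eb ?W (V - {s} - ?W)" using biconn[OF sV] unfolding connected_on_def by blast
    moreover have "V - {s} - ?W = Z \<union> K" using ZR KV by (auto simp: R_def)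
    moreover have "eb ?W (Z \<union> K) = eb ?W Z + eb ?W K"
      using ZR fR fK by (intro eb_Un_right) (auto simp: R_def intro: finite_subset)
    ultimately have "0 < eb ?W K" using ZR eb_sym[of ?W Z] by simp
    then obtain c where c: "c \<in> ?W" "0 < eb {c} K"
      using fR fK by (auto simp: eb_pos_iff)
    then have "eb {s} Z \<le> 1" using ZR by (intro barrier[of c]) auto
    then show False using sZ by simp
  qed
  have fZ: "finite Z" using fR RZ by simp
  have V_eq: "V = K \<union> insert s Z" and disj: "K \<inter> Z = {}" "s \<notin> Z" "s \<notin> K"
    using RZ KV sV by (auto simp: R_def)
  have ZX: "Z \<subseteq> X - {s}" using V_eq disj KV by auto
  have loop_free: "eb {v} (A - {v}) = eb {v} A" if "finite A" for v A
    using that by (cases "v \<in> A") (simp_all add: eb_singleton sum.remove)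
  have cut_Z: "eb {s} S + eb S K + eb S (Z - S) = cut S" if "S \<subseteq> Z" for S
  proof -
    have "V - S = {s} \<union> (K \<union> (Z - S))" using V_eq disj that by auto
    then have "cut S = eb S {s} + (eb S K + eb S (Z - S))"
      using fZ fK disj by (simp only:) (subst eb_Un_right, auto)+
    then show ?thesis using eb_sym[of S "{s}"] by simp
  qed
  have deg3: "eb {c} Z + w s c + eb {c} K = 3" if "c \<in> Z" for c
  proof -
    have "cut {c} = 3" using cubic[of c] ZX that by (auto simp: tight_def)
    then show ?thesis using cut_Z[of "{c}"] that loop_free[OF fZ, of c] by (simp add: eb_singleton)
  qed
  obtain c where c: "c \<in> Z" "0 < eb {c} K"
  proof -
    have "Z \<subseteq> V - {s}" "Z \<noteq> {}" "Z \<noteq> V - {s}" "V - {s} - Z = K" using V_eq disj K_ne Z by auto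
    then have "0 < eb Z K" using biconn[OF sV] unfolding connected_on_def by metis
    then show thesis using that fZ fK by (auto simp: eb_pos_iff)
  qed
  \<comment> \<open>Each component of \<open>Z - {c}\<close> has at most one edge to \<open>s\<close> and at least one to \<open>c\<close>.\<close>
  have "sum (w s) (Z - {c}) \<le> sum (w c) (Z - {c})"
  proof (rule sum_le_sum_by_components)
    fix M assume M: "component_of w M (Z - {c})"
    then have MZ: "M \<subseteq> Z - {c}" "M \<noteq> {}" "connected_on w M" "eb M (Z - {c} - M) = 0"
      by (auto simp: component_of_def)
    have "0 < eb M (Z - M)" using ZR(2) MZ c unfolding connected_on_def by blast
    moreover have "eb M (Z - M) = eb M {c} + eb M (Z - {c} - M)"
    proof -
      have "Z - M - {c} = Z - {c} - M" "{c} \<subseteq> Z - M" using MZ c by auto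
      then show ?thesis using eb_split_right[of "Z - M" "{c}" w M] fZ by simp
    qed
    ultimately have "1 \<le> sum (w c) M" using MZ eb_sym[of M "{c}"] by (simp add: eb_singleton(1))
    moreover have "sum (w s) M \<le> 1" using barrier[of c M] c MZ RZ by (simp add: eb_singleton(1))
    ultimately show "sum (w s) M \<le> sum (w c) M" by simp
  qed (simp add: fZ)
  then have "sum (w s) Z \<le> w s c + eb {c} Z"
    using sum.remove[OF fZ c(1), of "w s"] sum.remove[OF fZ c(1), of "w c"] by (simp add: eb_singleton(1))
  then have sum_s: "sum (w s) Z = 2" using deg3[OF c(1)] c sZ by (simp add: eb_singleton(1))
  then obtain x where x: "x \<in> Z" "0 < w s x" by (metis not_gr_zero sum.neutral zero_neq_numeral)
  \<comment> \<open>The two edges from \<open>s\<close> into \<open>Z\<close> are the ends of the corridor; if they are parallel, both are at \<open>x\<close>.\<close>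
  define k where "k v = eb {v} K" for v
  define p where "p v = (of_bool (v = x) :: nat)" for v
  define q where "q v = w s v - p v" for v
  have pq: "p v + q v = w s v" for v using x by (simp add: p_def q_def)
  have sum_p: "sum p Z = 1" using fZ x by (simp add: p_def of_bool_def sum.delta')
  have sum_pq: "sum p S + sum q S = eb {s} S" for S
    using pq by (simp add: eb_singleton flip: sum.distrib)
  have sum_q: "sum q Z = 1" using sum_pq[of Z] sum_p sum_s by (simp add: eb_singleton)
  have sum_k: "sum k S = eb S K" for S by (simp add: k_def edges_between_def)
  have corr: "corridor k Z p q" unfolding corridor_def
  proof (intro conjI allI ballI impI)
    fix S assume S: "S \<subseteq> Z" "S \<noteq> {}"
    then have "3 \<le> cut S" using V_eq disj by (intro cut_ge) auto
    then show "3 \<le> sum p S + sum q S + sum k S + eb S (Z - S)"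
      using cut_Z[OF S(1)] sum_pq sum_k by simp
  next
    fix a assume "a \<in> Z" "0 < k a"
    then show "p a + q a + k a + eb {a} Z \<le> 3" using deg3[of a] pq[of a] by (simp add: k_def)
  next
    fix a S assume a: "a \<in> Z" "0 < k a" and S: "S \<subseteq> Z - {a}" "connected_on w S"
    then have "sum p S + sum q S \<le> 1" using barrier[of a S] RZ sum_pq by (simp add: k_def)
    then show "sum p S = 0 \<or> sum q S = 0" by auto
  qed (use fZ ZR sum_p sum_q in auto)
  obtain L where L: "traces k Z p q L" using corridor_is_path[OF corr] by blast
  then have setL: "set L = Z" "distinct L" by (auto simp: traces_def)
  show thesis
  proof (rule that[of K s L])
    show "V = K \<union> insert s (set L)" "K \<inter> insert s (set L) = {}" "s \<notin> set L" "distinct L" "L \<noteq> []" "K \<noteq> {}"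
      using setL V_eq disj x K_ne by auto
    show "connected_on w K" by fact
    show "\<forall>u\<in>set L. \<forall>v\<in>set L. w u v = count (path_edges L) {u, v}"
      "\<forall>v\<in>set L. w s v = of_bool (v = hd L) + of_bool (v = last L)"
      "\<forall>v\<in>set L. eb {v} K = 1"
      using L pq by (simp_all add: traces_def k_def flip: pq)
    have "V - {s} = Z \<union> K" using V_eq disj by auto
    then have "cut {s} = eb {s} Z + eb {s} K"
      using fZ fK disj by (simp only:) (subst eb_Un_right, auto)
    moreover have "3 \<le> cut {s}" using sV x V_eq disj by (intro cut_ge) auto
    ultimately show "1 \<le> eb {s} K" using sum_s by (simp add: eb_singleton)
  next
    show "\<forall>x\<in>K. \<exists>A \<subseteq> K. x \<in> A \<and> cut A = 3"
    proof
      fix y assume y: "y \<in> K"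
      show "\<exists>A \<subseteq> K. y \<in> A \<and> cut A = 3"
      proof (cases "y \<in> X")
        case True
        then show ?thesis using cubic[of y] y disj by (intro exI[of _ "{y}"]) (auto simp: tight_def)
      next
        case False
        then show ?thesis using y KV XV cut_compl[OF XV(1)] by (intro exI[of _ "V - X"]) auto
      qed
    qed
  next
    show "\<forall>x\<in>K. \<forall>y\<in>K. x \<noteq> y \<longrightarrow> (\<exists>A \<subseteq> K. cut A = 3 \<and> (x \<in> A) \<noteq> (y \<in> A))"
    proof (intro ballI impI)
      fix y y' assume y: "y \<in> K" "y' \<in> K" "y \<noteq> y'"
      show "\<exists>A \<subseteq> K. cut A = 3 \<and> (y \<in> A) \<noteq> (y' \<in> A)"
      proof (cases "y \<in> X \<or> y' \<in> X")
        case True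
        then show ?thesis
        proof
          assume "y \<in> X"
          then show ?thesis using cubic[of y] y disj by (intro exI[of _ "{y}"]) (auto simp: tight_def)
        next
          assume "y' \<in> X"
          then show ?thesis using cubic[of y'] y disj by (intro exI[of _ "{y'}"]) (auto simp: tight_def)
        qed
      next
        case False
        have "y \<in> V" "y' \<in> V" using y V_eq by auto
        then obtain A where A: "tight A" "y \<in> A" "y' \<notin> A" using separating y by blast
        have AV: "A \<subseteq> V" using A by (auto simp: tight_def)
        then consider "X \<subseteq> A" | "A \<inter> X = {}"
          using tight_uncross[OF A(1) X(1)] A False y V_eq by blast
        then show ?thesis
        proof cases
          case 1
          then have "V - A \<subseteq> K" using KV by auto
          then show ?thesis using A AV cut_compl[OF AV] \<open>y' \<in> V\<close>
            by (intro exI[of _ "V - A"]) (auto simp: tight_def)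
        next
          case 2
          then have "A \<subseteq> K" using KV AV by auto
          then show ?thesis using A by (auto simp: tight_def)
        qed
      qed
    qed
  qed
qed

end

section \<open>Menger's theorem for multigraphs\<close>

definition weight :: "'a mgraph \<Rightarrow> 'a \<Rightarrow> 'a \<Rightarrow> nat" where
  "weight G x y = count (edges G) {x, y}"

lemma multiplicity_weight:
  assumes "multigraph G"
  shows "multiplicity (weight G)"
proof
  show "weight G x y = weight G y x" for x y by (simp add: weight_def insert_commute)
  show "weight G x x = 0" for x
    using assms by (auto simp: weight_def multigraph_def count_eq_zero_iff)
qed

text \<open>The net flow of one unit sent along a path.\<close>
fun path_flow :: "'a list \<Rightarrow> 'a \<Rightarrow> 'a \<Rightarrow> int" where
  "path_flow (x # y # xs) a b =
     of_bool (a = x \<and> b = y) - of_bool (a = y \<and> b = x) + path_flow (y # xs) a b"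
| "path_flow _ a b = 0"

text \<open>Flows are net flows with values in the integers: \<open>g x y\<close> and \<open>g y x\<close> cancel, and a path in which each
  step can take one more unit is augmenting, also when it reduces flow in the opposite direction.
  Capacities are imposed separately.\<close>
definition flow :: "'a set \<Rightarrow> 'a \<Rightarrow> 'a \<Rightarrow> int \<Rightarrow> ('a \<Rightarrow> 'a \<Rightarrow> int) \<Rightarrow> bool" where
  "flow V u v k g \<longleftrightarrow> (\<forall>x y. g x y + g y x = 0) \<and>
     (\<forall>x\<in>V. (\<Sum>y\<in>V. g x y) = k * (of_bool (x = u) - of_bool (x = v)))"

lemma path_flow_antisym: "path_flow p a b + path_flow p b a = 0"
proof (induction p rule: path_edges.induct)
  case (1 x y xs)
  have "(of_bool (b = y \<and> a = x) :: int) = of_bool (a = x \<and> b = y)"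
    "(of_bool (b = x \<and> a = y) :: int) = of_bool (a = y \<and> b = x)"
    by (simp_all only: conj_commute)
  then show ?case using 1 unfolding path_flow.simps by linarith
qed simp_all

lemma path_flow_notin: "a \<notin> set p \<Longrightarrow> path_flow p a b = 0" "b \<notin> set p \<Longrightarrow> path_flow p a b = 0"
  by (induction p rule: path_edges.induct) simp_all

lemma path_flow_bounds:
  assumes "distinct p" "successively r p"
  shows "path_flow p a b \<le> 1" and "0 < path_flow p a b \<Longrightarrow> r a b"
    and "a \<noteq> b \<Longrightarrow> \<bar>path_flow p a b\<bar> = int (count (path_edges p) {a, b})"
proof -
  have "path_flow p a b \<le> 1 \<and> (0 < path_flow p a b \<longrightarrow> r a b) \<and>
    (a \<noteq> b \<longrightarrow> \<bar>path_flow p a b\<bar> = int (count (path_edges p) {a, b}))"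
    using assms
  proof (induction p a b rule: path_flow.induct)
    case (1 x y xs a b)
    show ?case
    proof (cases "a = x \<or> b = x")
      case True
      have "x \<notin> set (y # xs)" using 1(2) by simp
      then have "a \<notin> set (y # xs) \<or> b \<notin> set (y # xs)" using True by blast
      then have "path_flow (y # xs) a b = 0" "count (path_edges (y # xs)) {a, b} = 0"
        by (metis path_flow_notin, metis count_path_edges_notin)
      then have pf: "path_flow (x # y # xs) a b = of_bool (a = x \<and> b = y) - of_bool (a = y \<and> b = x)"
        and ct: "count (path_edges (x # y # xs)) {a, b} = of_bool ({x, y} = {a, b})" by simp_all
      have rxy: "r x y" "x \<noteq> y" using 1(2,3) by auto
      show ?thesis unfolding pf ct doubleton_eq_iff
      proof (cases "a = x \<and> b = y")
        case True
        then show "of_bool (a = x \<and> b = y) - of_bool (a = y \<and> b = x) \<le> (1 :: int) \<and>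
          (0 < (of_bool (a = x \<and> b = y) - of_bool (a = y \<and> b = x) :: int) \<longrightarrow> r a b) \<and>
          (a \<noteq> b \<longrightarrow> \<bar>of_bool (a = x \<and> b = y) - of_bool (a = y \<and> b = x)\<bar> =
            int (of_bool (x = a \<and> y = b \<or> x = b \<and> y = a)))" using rxy by simp
      next
        case False
        then show "of_bool (a = x \<and> b = y) - of_bool (a = y \<and> b = x) \<le> (1 :: int) \<and>
          (0 < (of_bool (a = x \<and> b = y) - of_bool (a = y \<and> b = x) :: int) \<longrightarrow> r a b) \<and>
          (a \<noteq> b \<longrightarrow> \<bar>of_bool (a = x \<and> b = y) - of_bool (a = y \<and> b = x)\<bar> =
            int (of_bool (x = a \<and> y = b \<or> x = b \<and> y = a)))" using rxy by auto
      qed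
    next
      case False
      then have "path_flow (x # y # xs) a b = path_flow (y # xs) a b"
        "count (path_edges (x # y # xs)) {a, b} = count (path_edges (y # xs)) {a, b}"
        by (auto simp: doubleton_eq_iff)
      then show ?thesis using 1 by (simp del: path_flow.simps path_edges.simps)
    qed
  qed auto
  then show "path_flow p a b \<le> 1" "0 < path_flow p a b \<Longrightarrow> r a b"
    "a \<noteq> b \<Longrightarrow> \<bar>path_flow p a b\<bar> = int (count (path_edges p) {a, b})" by auto
qed

lemma flow_path:
  assumes "finite V" "p \<noteq> []" "set p \<subseteq> V"
  shows "flow V (hd p) (last p) 1 (path_flow p)"
proof -
  have delta: "(\<Sum>b\<in>V. of_bool (b = z) :: int) = 1" if "z \<in> V" for z
    using that assms(1) unfolding of_bool_def by simp
  have "(\<Sum>y\<in>V. path_flow p a y) = of_bool (a = hd p) - of_bool (a = last p)" for a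
    using assms(2,3)
  proof (induction p rule: path_edges.induct)
    case (1 x y xs)
    have "(\<Sum>b\<in>V. of_bool (a = x \<and> b = y) :: int) = of_bool (a = x)"
      "(\<Sum>b\<in>V. of_bool (a = y \<and> b = x) :: int) = of_bool (a = y)"
      using delta[of x] delta[of y] 1(3) by (cases "a = x"; cases "a = y"; simp)+
    then show ?case using 1 by (simp add: sum.distrib sum_subtractf)
  qed auto
  then show ?thesis unfolding flow_def by (simp add: path_flow_antisym)
qed

lemma flow_add:
  assumes g: "flow V u v k g" and h: "flow V u v l h"
  shows "flow V u v (k + l) (\<lambda>x y. g x y + h x y)"
  unfolding flow_def
proof (intro conjI allI ballI)
  fix x y
  have "g x y + g y x = 0" "h x y + h y x = 0" using g h by (auto simp: flow_def)
  then show "(g x y + h x y) + (g y x + h y x) = 0" by linarith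
next
  fix x assume "x \<in> V"
  then show "(\<Sum>y\<in>V. g x y + h x y) = (k + l) * (of_bool (x = u) - of_bool (x = v))"
    using g h unfolding flow_def sum.distrib distrib_right by simp
qed

lemma flow_diff:
  assumes g: "flow V u v k g" and h: "flow V u v l h"
  shows "flow V u v (k - l) (\<lambda>x y. g x y - h x y)"
  unfolding flow_def
proof (intro conjI allI ballI)
  fix x y
  have "g x y + g y x = 0" "h x y + h y x = 0" using g h by (auto simp: flow_def)
  then show "(g x y - h x y) + (g y x - h y x) = 0" by linarith
next
  fix x assume "x \<in> V"
  then show "(\<Sum>y\<in>V. g x y - h x y) = (k - l) * (of_bool (x = u) - of_bool (x = v))"
    using g h unfolding flow_def sum_subtractf left_diff_distrib by simp
qed

lemma flow_across_cut:
  assumes g: "flow V u v k g" and "finite V" "A \<subseteq> V" "u \<in> A" "v \<notin> A"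
  shows "(\<Sum>x\<in>A. \<Sum>y\<in>V - A. g x y) = k"
proof -
  have anti: "g x y = - g y x" for x y using g by (simp add: flow_def eq_neg_iff_add_eq_0)
  have fA: "finite A" using assms finite_subset by blast
  have "(\<Sum>x\<in>A. \<Sum>y\<in>A. g x y) = (\<Sum>y\<in>A. \<Sum>x\<in>A. g x y)" by (rule sum.swap)
  also have "\<dots> = (\<Sum>x\<in>A. \<Sum>y\<in>A. - g x y)" by (intro sum.cong refl) (use anti in blast)
  also have "\<dots> = - (\<Sum>x\<in>A. \<Sum>y\<in>A. g x y)" by (simp add: sum_negf)
  finally have 0: "(\<Sum>x\<in>A. \<Sum>y\<in>A. g x y) = 0" by simp
  have "(\<Sum>x\<in>A. \<Sum>y\<in>V. g x y) = (\<Sum>x\<in>A. k * of_bool (x = u))"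
    using g assms by (intro sum.cong) (auto simp: flow_def)
  also have "\<dots> = k" using assms fA by (simp add: of_bool_def if_distrib sum.delta' cong: if_cong)
  finally have "k = (\<Sum>x\<in>A. (\<Sum>y\<in>V - A. g x y) + (\<Sum>y\<in>A. g x y))"
    using sum.subset_diff[OF assms(3,2)] by (metis (no_types, lifting) sum.cong)
  then show ?thesis using 0 by (simp add: sum.distrib)
qed

text \<open>The vertices that such paths reach from \<open>u\<close> would form a blocking cut if \<open>v\<close> were not
  among them.\<close>
lemma path_if_no_blocking_cut:
  assumes "u \<in> V" and cuts: "\<And>A. A \<subseteq> V \<Longrightarrow> u \<in> A \<Longrightarrow> v \<notin> A \<Longrightarrow> \<exists>x\<in>A. \<exists>y\<in>V - A. r x y"
  obtains p where "p \<noteq> []" "hd p = u" "last p = v" "distinct p" "set p \<subseteq> V" "successively r p"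
proof -
  define Q where "Q x p \<longleftrightarrow> p \<noteq> [] \<and> hd p = u \<and> last p = x \<and> distinct p \<and> set p \<subseteq> V \<and> successively r p" for x p
  define A where "A = {x. \<exists>p. Q x p}"
  have "Q u [u]" using assms(1) by (simp add: Q_def)
  then have uA: "u \<in> A" by (auto simp: A_def)
  have AV: "A \<subseteq> V" by (auto simp: A_def Q_def)
  have "v \<in> A"
  proof (rule ccontr)
    assume "v \<notin> A"
    then obtain x y where xy: "x \<in> A" "y \<in> V" "y \<notin> A" "r x y" using cuts[OF AV uA] by auto
    then obtain p where p: "Q x p" by (auto simp: A_def)
    show False
    proof (cases "y \<in> set p")
      case True
      then obtain p1 p2 where p12: "p = (p1 @ [y]) @ p2" using split_list by (metis append.assoc append_Cons append_Nil)
      then have "successively r (p1 @ [y])" using p p12 successively_append_iff[of r "p1 @ [y]" p2] by (simp add: Q_def)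
      then have "Q y (p1 @ [y])" using p p12 unfolding Q_def by (cases p1) auto
      then show False using xy by (auto simp: A_def)
    next
      case False
      then have "Q y (p @ [y])" using p xy unfolding Q_def by (auto simp: successively_append_iff)
      then show False using xy by (auto simp: A_def)
    qed
  qed
  then show thesis using that by (auto simp: A_def Q_def)
qed

text \<open>As long as the value is below the size of every cut, no cut is saturated, so there is an augmenting path.
  Distinctness of its vertices ensures that each pair is augmented only once.\<close>
lemma max_flow:
  assumes V: "finite V" "u \<in> V" and sym: "\<And>x y. w x y = w y x"
    and cuts: "\<And>A. A \<subseteq> V \<Longrightarrow> u \<in> A \<Longrightarrow> v \<notin> A \<Longrightarrow> k \<le> edges_between w A (V - A)"
  shows "\<exists>g. flow V u v (int k) g \<and> (\<forall>x y. g x y \<le> int (w x y))"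
  using cuts
proof (induction k)
  case 0
  show ?case by (intro exI[of _ "\<lambda>_ _. 0"]) (simp add: flow_def)
next
  case (Suc k)
  then obtain g where g: "flow V u v (int k) g" and cap: "\<And>x y. g x y \<le> int (w x y)"
    using Suc_leD by blast
  have unsaturated: "\<exists>x\<in>A. \<exists>y\<in>V - A. g x y < int (w x y)" if A: "A \<subseteq> V" "u \<in> A" "v \<notin> A" for A
  proof (rule ccontr)
    assume "\<not> ?thesis"
    then have "(\<Sum>x\<in>A. \<Sum>y\<in>V - A. int (w x y)) \<le> (\<Sum>x\<in>A. \<Sum>y\<in>V - A. g x y)"
      by (intro sum_mono) (auto simp: not_less)
    also have "\<dots> = int k" by (rule flow_across_cut[OF g V(1) A])
    finally have "int (edges_between w A (V - A)) \<le> int k" by (simp add: edges_between_def)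
    then show False using Suc.prems[OF A] by simp
  qed
  obtain p where p: "p \<noteq> []" "hd p = u" "last p = v" "distinct p" "set p \<subseteq> V"
      "successively (\<lambda>x y. g x y < int (w x y)) p"
    by (rule path_if_no_blocking_cut[OF V(2) unsaturated])
  have "flow V u v (int k + 1) (\<lambda>x y. g x y + path_flow p x y)"
    using flow_add[OF g] flow_path[OF V(1) p(1,5)] p(2,3) by blast
  moreover have "g x y + path_flow p x y \<le> int (w x y)" for x y
    using path_flow_bounds(1,2)[OF p(4,6), of x y] cap[of x y] by fastforce
  ultimately show ?case by (intro exI[of _ "\<lambda>x y. g x y + path_flow p x y"]) (simp add: add.commute)
qed

text \<open>While the value is positive, flow crosses every cut, so there is a path along positive flow;
  subtracting it uses up exactly the edges of that path.\<close>
lemma flow_decomposition: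
  assumes V: "finite V" "u \<in> V" and g: "flow V u v (int k) g"
  shows "\<exists>ps. length ps = k \<and>
     (\<forall>p\<in>set ps. p \<noteq> [] \<and> hd p = u \<and> last p = v \<and> distinct p \<and> set p \<subseteq> V) \<and>
     (\<forall>a b. a \<noteq> b \<longrightarrow> int (count (sum_list (map path_edges ps)) {a, b}) \<le> \<bar>g a b\<bar>)"
  using g
proof (induction k arbitrary: g)
  case 0
  show ?case by (intro exI[of _ "[]"]) simp
next
  case (Suc k)
  have positive: "\<exists>x\<in>A. \<exists>y\<in>V - A. 0 < g x y" if A: "A \<subseteq> V" "u \<in> A" "v \<notin> A" for A
  proof (rule ccontr)
    assume "\<not> ?thesis"
    then have "(\<Sum>x\<in>A. \<Sum>y\<in>V - A. g x y) \<le> 0" by (intro sum_nonpos) (auto simp: not_less)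
    then show False using flow_across_cut[OF Suc.prems V(1) A] by simp
  qed
  obtain p where p: "p \<noteq> []" "hd p = u" "last p = v" "distinct p" "set p \<subseteq> V"
      "successively (\<lambda>x y. 0 < g x y) p"
    by (rule path_if_no_blocking_cut[OF V(2) positive])
  define h where "h x y = g x y - path_flow p x y" for x y
  have "flow V u v (int (Suc k) - 1) h" unfolding h_def
    using flow_diff[OF Suc.prems] flow_path[OF V(1) p(1,5)] p(2,3) by blast
  then obtain ps where ps: "length ps = k"
     "\<forall>p\<in>set ps. p \<noteq> [] \<and> hd p = u \<and> last p = v \<and> distinct p \<and> set p \<subseteq> V"
     and le: "\<And>a b. a \<noteq> b \<Longrightarrow> int (count (sum_list (map path_edges ps)) {a, b}) \<le> \<bar>h a b\<bar>"
    using Suc.IH[of h] by auto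
  have "int (count (sum_list (map path_edges (p # ps))) {a, b}) \<le> \<bar>g a b\<bar>" if ab: "a \<noteq> b" for a b
  proof -
    have anti: "g a b + g b a = 0" using Suc.prems by (simp add: flow_def)
    have "path_flow p a b + path_flow p b a = 0" by (rule path_flow_antisym)
    then have "\<bar>h a b\<bar> + \<bar>path_flow p a b\<bar> = \<bar>g a b\<bar>"
      using path_flow_bounds(1,2)[OF p(4,6), of a b] path_flow_bounds(1,2)[OF p(4,6), of b a] anti
      unfolding h_def by linarith
    then show ?thesis using le[OF ab] path_flow_bounds(3)[OF p(4,6) ab] by simp
  qed
  then show ?case using ps p by (intro exI[of _ "p # ps"]) auto
qed

lemma count_path_edges_card: "distinct p \<Longrightarrow> e \<in># path_edges p \<Longrightarrow> card e = 2"
  by (induction p rule: path_edges.induct) (auto simp: card_insert_if)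

lemma path_crosses_cut:
  assumes "p \<noteq> []" "hd p \<in> A" "last p \<notin> A" "set p \<subseteq> V"
  shows "\<exists>x\<in>A. \<exists>y\<in>V - A. {x, y} \<in># path_edges p"
  using assms
proof (induction p rule: path_edges.induct)
  case (1 x y xs)
  show ?case
  proof (cases "y \<in> A")
    case True
    then have "\<exists>a\<in>A. \<exists>b\<in>V - A. {a, b} \<in># path_edges (y # xs)" using 1 by simp
    then show ?thesis by auto
  next
    case False
    then show ?thesis using 1(3,5) by auto
  qed
qed auto

lemma edge_disjoint_paths_le_cut:
  assumes G: "finite (verts G)" and ps: "edge_disjoint_paths G u v ps"
    and A: "A \<subseteq> verts G" "u \<in> A" "v \<notin> A"
  shows "length ps \<le> edges_between (weight G) A (verts G - A)"
proof -
  define c where "c M = edges_between (\<lambda>x y. count M {x, y}) A (verts G - A)" for M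
  have fA: "finite A" using A G finite_subset by blast
  have add: "c (M + N) = c M + c N" for M N
    by (simp add: c_def edges_between_def sum.distrib)
  have one: "1 \<le> c (path_edges p)" if "is_path G u p v" for p
  proof -
    have "\<exists>x\<in>A. \<exists>y\<in>verts G - A. {x, y} \<in># path_edges p"
      using that A by (intro path_crosses_cut) (auto simp: is_path_def)
    then have "0 < c (path_edges p)" unfolding c_def
      using G fA by (subst eb_pos_iff) (auto simp: count_greater_zero_iff)
    then show ?thesis by simp
  qed
  have paths: "\<forall>p\<in>set ps. is_path G u p v" and sub: "sum_list (map path_edges ps) \<subseteq># edges G"
    using ps by (auto simp: edge_disjoint_paths_def)
  have "length qs \<le> c (sum_list (map path_edges qs))" if "\<forall>p\<in>set qs. is_path G u p v" for qs
    using that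
  proof (induction qs)
    case (Cons q qs)
    then show ?case using one[of q] by (simp add: add)
  qed simp
  then have "length ps \<le> c (sum_list (map path_edges ps))" using paths by blast
  also have "\<dots> \<le> c (edges G)" unfolding c_def edges_between_def
    using sub by (intro sum_mono) (rule mset_subset_eq_count)
  finally show ?thesis by (simp add: c_def weight_def[abs_def])
qed

text \<open>The graph is undirected, but net flow uses each edge in one direction only, so the paths of a flow
  decomposition respect the multiplicities.\<close>
lemma menger:
  assumes G: "multigraph G" and uv: "u \<in> verts G"
  shows "(\<exists>ps. edge_disjoint_paths G u v ps \<and> length ps = k) \<longleftrightarrow>
    (\<forall>A. A \<subseteq> verts G \<longrightarrow> u \<in> A \<longrightarrow> v \<notin> A \<longrightarrow> k \<le> edges_between (weight G) A (verts G - A))"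
    (is "?L \<longleftrightarrow> ?R")
proof
  assume ?L then show ?R using edge_disjoint_paths_le_cut G by (auto simp: multigraph_def)
next
  assume R: ?R
  have fin: "finite (verts G)" using G by (simp add: multigraph_def)
  interpret multiplicity "weight G" using multiplicity_weight[OF G] .
  obtain g where g: "flow (verts G) u v (int k) g" "\<And>x y. g x y \<le> int (weight G x y)"
    using max_flow[of "verts G" u "weight G" v k] fin uv sym R by blast
  obtain ps where ps: "length ps = k"
     "\<forall>p\<in>set ps. p \<noteq> [] \<and> hd p = u \<and> last p = v \<and> distinct p \<and> set p \<subseteq> verts G"
     and le: "\<And>a b. a \<noteq> b \<Longrightarrow> int (count (sum_list (map path_edges ps)) {a, b}) \<le> \<bar>g a b\<bar>"
    using flow_decomposition[OF fin uv g(1)] by blast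
  have sub: "sum_list (map path_edges ps) \<subseteq># edges G"
  proof (rule mset_subset_eqI)
    fix e
    show "count (sum_list (map path_edges ps)) e \<le> count (edges G) e"
    proof (cases "e \<in># sum_list (map path_edges ps)")
      case True
      then obtain p where "p \<in> set ps" "e \<in># path_edges p" by (induction ps) auto
      then have "card e = 2" using ps(2) count_path_edges_card by blast
      then obtain a b where e: "e = {a, b}" "a \<noteq> b" by (auto simp: card_2_iff)
      have "g a b + g b a = 0" using g(1) by (simp add: flow_def)
      then have "\<bar>g a b\<bar> \<le> int (weight G a b)" using g(2)[of a b] g(2)[of b a] sym[of a b] by linarith
      then show ?thesis using le[of a b] e by (simp add: weight_def)
    next
      case False
      then have "count (sum_list (map path_edges ps)) e = 0" by (simp only: not_in_iff)
      then show ?thesis by simp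
    qed
  qed
  have inner: "path_edges p \<subseteq># sum_list (map path_edges ps)" if "p \<in> set ps" for p
    using that by (induction ps) (auto intro: subset_mset.add_increasing subset_mset.add_increasing2)
  then have "is_path G u p v" if "p \<in> set ps" for p
    using bspec[OF ps(2) that] subset_mset.order_trans[OF inner[OF that] sub]
    unfolding is_path_def by blast
  then show ?L using ps(1) sub unfolding edge_disjoint_paths_def by blast
qed

text \<open>A bound on the number of edge-disjoint paths is the failure of Menger's condition for one more
  path, which yields a small cut.\<close>
lemma exactly_edge_connected_iff:
  assumes G: "multigraph G"
  shows "exactly_edge_connected k G \<longleftrightarrow> 2 \<le> card (verts G) \<and> exact_cuts k (verts G) (weight G)"
proof -
  have fin: "finite (verts G)" using G by (simp add: multigraph_def)
  have le_cut: "(\<forall>ps. edge_disjoint_paths G u v ps \<longrightarrow> length ps \<le> k) \<longleftrightarrow>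
      (\<exists>A. A \<subseteq> verts G \<and> u \<in> A \<and> v \<notin> A \<and> edges_between (weight G) A (verts G - A) \<le> k)"
    (is "?L \<longleftrightarrow> ?R") if u: "u \<in> verts G" for u v
  proof
    assume ?L
    then have "\<not> (\<exists>ps. edge_disjoint_paths G u v ps \<and> length ps = Suc k)" by fastforce
    then show ?R unfolding menger[OF G u] by (auto simp: not_less_eq_eq)
  next
    assume ?R
    then show ?L using edge_disjoint_paths_le_cut[OF fin] order_trans by blast
  qed
  then have "exactly_edge_connected k G \<longleftrightarrow> 2 \<le> card (verts G) \<and>
    (\<forall>u\<in>verts G. \<forall>v\<in>verts G. u \<noteq> v \<longrightarrow>
      (\<forall>A. A \<subseteq> verts G \<longrightarrow> u \<in> A \<longrightarrow> v \<notin> A \<longrightarrow> k \<le> edges_between (weight G) A (verts G - A)) \<and>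
      (\<exists>A. A \<subseteq> verts G \<and> u \<in> A \<and> v \<notin> A \<and> edges_between (weight G) A (verts G - A) \<le> k))"
    unfolding exactly_edge_connected_def
    by (intro conj_cong ball_cong imp_cong refl menger[OF G] le_cut)
  also have "\<dots> \<longleftrightarrow> 2 \<le> card (verts G) \<and> exact_cuts k (verts G) (weight G)"
    unfolding exact_cuts_def
  proof (intro conj_cong refl iffI)
    assume L: "\<forall>u\<in>verts G. \<forall>v\<in>verts G. u \<noteq> v \<longrightarrow>
      (\<forall>A. A \<subseteq> verts G \<longrightarrow> u \<in> A \<longrightarrow> v \<notin> A \<longrightarrow> k \<le> edges_between (weight G) A (verts G - A)) \<and>
      (\<exists>A. A \<subseteq> verts G \<and> u \<in> A \<and> v \<notin> A \<and> edges_between (weight G) A (verts G - A) \<le> k)"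
    show "(\<forall>A. A \<subseteq> verts G \<longrightarrow> A \<noteq> {} \<longrightarrow> A \<noteq> verts G \<longrightarrow>
        k \<le> edges_between (weight G) A (verts G - A)) \<and>
      (\<forall>x\<in>verts G. \<forall>y\<in>verts G. x \<noteq> y \<longrightarrow>
        (\<exists>A. A \<subseteq> verts G \<and> x \<in> A \<and> y \<notin> A \<and> edges_between (weight G) A (verts G - A) = k))"
    proof (intro conjI allI ballI impI)
      fix A assume A: "A \<subseteq> verts G" "A \<noteq> {}" "A \<noteq> verts G"
      then obtain x y where "x \<in> A" "y \<in> verts G - A" by blast
      then show "k \<le> edges_between (weight G) A (verts G - A)"
        using L[rule_format, of x y] A by blast
    next
      fix x y assume "x \<in> verts G" "y \<in> verts G" "x \<noteq> y"
      then obtain A where A: "A \<subseteq> verts G" "x \<in> A" "y \<notin> A"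
        "edges_between (weight G) A (verts G - A) \<le> k" "k \<le> edges_between (weight G) A (verts G - A)"
        using L[rule_format, of x y] by blast
      then show "\<exists>A. A \<subseteq> verts G \<and> x \<in> A \<and> y \<notin> A \<and> edges_between (weight G) A (verts G - A) = k"
        by (intro exI[of _ A]) simp
    qed
  next
    assume R: "(\<forall>A. A \<subseteq> verts G \<longrightarrow> A \<noteq> {} \<longrightarrow> A \<noteq> verts G \<longrightarrow>
        k \<le> edges_between (weight G) A (verts G - A)) \<and>
      (\<forall>x\<in>verts G. \<forall>y\<in>verts G. x \<noteq> y \<longrightarrow>
        (\<exists>A. A \<subseteq> verts G \<and> x \<in> A \<and> y \<notin> A \<and> edges_between (weight G) A (verts G - A) = k))"
    show "\<forall>u\<in>verts G. \<forall>v\<in>verts G. u \<noteq> v \<longrightarrow>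
      (\<forall>A. A \<subseteq> verts G \<longrightarrow> u \<in> A \<longrightarrow> v \<notin> A \<longrightarrow> k \<le> edges_between (weight G) A (verts G - A)) \<and>
      (\<exists>A. A \<subseteq> verts G \<and> u \<in> A \<and> v \<notin> A \<and> edges_between (weight G) A (verts G - A) \<le> k)"
    proof (intro conjI allI ballI impI)
      fix u v A assume "v \<in> verts G" "A \<subseteq> verts G" "u \<in> A" "v \<notin> A"
      then show "k \<le> edges_between (weight G) A (verts G - A)"
        using conjunct1[OF R, rule_format, of A] by blast
    next
      fix u v assume "u \<in> verts G" "v \<in> verts G" "u \<noteq> v"
      then obtain A where "A \<subseteq> verts G" "u \<in> A" "v \<notin> A" "edges_between (weight G) A (verts G - A) = k"
        using conjunct2[OF R, rule_format, of u v] by blast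
      then show "\<exists>A. A \<subseteq> verts G \<and> u \<in> A \<and> v \<notin> A \<and> edges_between (weight G) A (verts G - A) \<le> k"
        by (intro exI[of _ A]) simp
    qed
  qed
  finally show ?thesis .
qed

lemma connected_mgraph_iff:
  assumes G: "multigraph G"
  shows "connected_mgraph G \<longleftrightarrow> connected_on (weight G) (verts G)"
proof -
  have path: "(\<exists>p. is_path G u p v) \<longleftrightarrow>
      (\<forall>A. A \<subseteq> verts G \<longrightarrow> u \<in> A \<longrightarrow> v \<notin> A \<longrightarrow> 1 \<le> edges_between (weight G) A (verts G - A))"
    if u: "u \<in> verts G" for u v
    unfolding menger[OF G u, symmetric]
  proof
    assume "\<exists>p. is_path G u p v"
    then obtain p where "is_path G u p v" by blast
    then show "\<exists>ps. edge_disjoint_paths G u v ps \<and> length ps = 1"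
      by (intro exI[of _ "[p]"]) (auto simp: edge_disjoint_paths_def is_path_def)
  next
    assume "\<exists>ps. edge_disjoint_paths G u v ps \<and> length ps = 1"
    then obtain ps where "edge_disjoint_paths G u v ps" "length ps = 1" by blast
    then show "\<exists>p. is_path G u p v" by (cases ps) (auto simp: edge_disjoint_paths_def)
  qed
  show ?thesis unfolding connected_mgraph_def connected_on_def
  proof (intro iffI allI impI ballI)
    fix A assume L: "\<forall>u\<in>verts G. \<forall>v\<in>verts G. \<exists>p. is_path G u p v"
      and A: "A \<subseteq> verts G" "A \<noteq> {}" "A \<noteq> verts G"
    then obtain x y where xy: "x \<in> A" "y \<in> verts G - A" by blast
    then have "\<exists>p. is_path G x p y" using L A by blast
    then show "0 < edges_between (weight G) A (verts G - A)"
      using path[of x y] A xy by (simp add: Suc_le_eq) blast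
  next
    fix u v assume R: "\<forall>A. A \<subseteq> verts G \<longrightarrow> A \<noteq> {} \<longrightarrow> A \<noteq> verts G \<longrightarrow>
        0 < edges_between (weight G) A (verts G - A)"
      and uv: "u \<in> verts G" "v \<in> verts G"
    show "\<exists>p. is_path G u p v" unfolding path[OF uv(1)]
    proof (intro allI impI)
      fix A assume "A \<subseteq> verts G" "u \<in> A" "v \<notin> A"
      then show "1 \<le> edges_between (weight G) A (verts G - A)"
        using R[rule_format, of A] uv by (auto simp: Suc_le_eq)
    qed
  qed
qed

section \<open>Separation at a vertex and contraction\<close>

lemma connected_onD:
  "connected_on w S \<Longrightarrow> A \<subseteq> S \<Longrightarrow> A \<noteq> {} \<Longrightarrow> A \<noteq> S \<Longrightarrow> 0 < edges_between w A (S - A)"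
  by (simp add: connected_on_def)

context exactly_three_connected
begin

lemma connected: "connected_on w V"
  unfolding connected_on_def
proof (intro allI impI)
  fix A assume "A \<subseteq> V" "A \<noteq> {}" "A \<noteq> V"
  then have "3 \<le> cut A" by (rule cut_ge)
  then show "0 < cut A" by simp
qed

text \<open>A vertex set in one side that misses the articulation point \<open>u\<close> has the same cut in the side as in \<open>V\<close>;
  if it contains \<open>u\<close>, its complement misses it. A tight set of \<open>V\<close> restricts to a set whose cut in the
  side is not larger.\<close>
lemma exact_side:
  assumes V: "V = insert u (A \<union> B)" "u \<notin> A" "u \<notin> B" "A \<inter> B = {}" and zero: "eb A B = 0"
  shows "exact_cuts 3 (insert u A) w"
proof -
  let ?W = "insert u A"
  have fA: "finite A" "finite B" using V finite_V by auto
  have same: "eb S (?W - S) = cut S" if S: "S \<subseteq> A" for S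
  proof -
    have fS: "finite S" using S fA finite_subset by blast
    have "eb S B \<le> eb A B" using S fA by (intro eb_mono) auto
    then have "eb S B = 0" using zero by simp
    moreover have "V - S = (?W - S) \<union> B" using V S by auto
    moreover have "eb S ((?W - S) \<union> B) = eb S (?W - S) + eb S B"
      using fA V by (intro eb_Un_right) auto
    ultimately show ?thesis by simp
  qed
  have ge: "3 \<le> eb S (?W - S)" if S: "S \<subseteq> ?W" "S \<noteq> {}" "S \<noteq> ?W" for S
  proof (cases "u \<in> S")
    case False
    then have "S \<subseteq> A" using S by auto
    then show ?thesis using same[of S] cut_ge[of S] S V by auto
  next
    case True
    then have SA: "?W - S \<subseteq> A" and ne: "?W - S \<noteq> {}" using S by auto
    have "3 \<le> cut (?W - S)" using SA ne V by (intro cut_ge) auto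
    also have "\<dots> = eb (?W - S) (?W - (?W - S))" using same[OF SA] by simp
    also have "\<dots> = eb S (?W - S)" using S by (simp add: double_diff eb_sym)
    finally show ?thesis .
  qed
  show ?thesis unfolding exact_cuts_def
  proof (intro conjI allI impI ballI)
    fix S assume "S \<subseteq> ?W" "S \<noteq> {}" "S \<noteq> ?W"
    then show "3 \<le> eb S (?W - S)" by (rule ge)
  next
    fix x y assume xy: "x \<in> ?W" "y \<in> ?W" "x \<noteq> y"
    then obtain T where T: "tight T" "x \<in> T" "y \<notin> T" using separating[of x y] V by auto
    have TV: "T \<subseteq> V" "cut T = 3" "finite T" using T fin by (auto simp: tight_def)
    have "eb (T \<inter> ?W) (?W - T \<inter> ?W) \<le> eb T (V - T)"
      using TV V finite_V by (intro eb_mono) auto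
    moreover have "3 \<le> eb (T \<inter> ?W) (?W - T \<inter> ?W)" using xy T by (intro ge) auto
    ultimately show "\<exists>S. S \<subseteq> ?W \<and> x \<in> S \<and> y \<notin> S \<and> eb S (?W - S) = 3"
      using TV xy T by (intro exI[of _ "T \<inter> ?W"]) auto
  qed
qed

end

text \<open>The weights \<open>w'\<close> describe the graph on \<open>insert u K\<close> that results from contracting \<open>C\<close> to \<open>u\<close>.\<close>
locale contraction = exactly_three_connected w V + contracted: multiplicity w'
  for w w' :: "'a \<Rightarrow> 'a \<Rightarrow> nat" and V +
  fixes K C :: "'a set" and u :: 'a
  assumes V_eq: "V = K \<union> C" and disjoint: "K \<inter> C = {}" and C_ne: "C \<noteq> {}" and new: "u \<notin> V"
    and w'_old: "x \<in> K \<Longrightarrow> y \<in> K \<Longrightarrow> w' x y = w x y"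
    and w'_new: "y \<in> K \<Longrightarrow> w' u y = edges_between w C {y}"
begin

text \<open>The preimage of a vertex set under the contraction. Cuts of the contracted graph are exactly the
  cuts of \<open>V\<close> that do not divide \<open>C\<close>.\<close>
definition lift where "lift S = (if u \<in> S then S - {u} \<union> C else S)"

lemma fin_parts: "finite K" "finite C"
  using finite_V V_eq by auto

lemma eb_lift_aux:
  assumes "S \<subseteq> K" "T \<subseteq> K" "S \<inter> T = {}"
  shows "edges_between w' (insert u S) T = eb (S \<union> C) T"
proof -
  have f: "finite S" "finite T" using assms fin_parts finite_subset by blast+
  have uS: "u \<notin> S" using assms new V_eq by auto
  have "edges_between w' (insert u S) T = (\<Sum>y\<in>T. w' u y) + edges_between w' S T"
    using f uS by (simp add: edges_between_def)
  also have "(\<Sum>y\<in>T. w' u y) = (\<Sum>y\<in>T. eb C {y})" using assms w'_new by (intro sum.cong) auto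
  also have "\<dots> = eb C T" by (simp add: eb_singleton) (simp add: edges_between_def sum.swap[of _ T C])
  also have "edges_between w' S T = eb S T" using assms by (intro eb_cong w'_old) auto
  also have "eb C T + eb S T = eb (S \<union> C) T"
    using f fin_parts assms disjoint by (subst eb_Un_left) auto
  finally show ?thesis .
qed

lemma eb_lift:
  assumes S: "S \<subseteq> insert u K" "T \<subseteq> insert u K" "S \<inter> T = {}"
  shows "edges_between w' S T = eb (lift S) (lift T)"
proof -
  consider "u \<in> S" "u \<notin> T" | "u \<notin> S" "u \<in> T" | "u \<notin> S" "u \<notin> T" using S by blast
  then show ?thesis
  proof cases
    case 1
    then show ?thesis using eb_lift_aux[of "S - {u}" T] S by (auto simp: lift_def insert_absorb)
  next
    case 2
    then have "edges_between w' T S = eb (lift T) (lift S)"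
      using eb_lift_aux[of "T - {u}" S] S by (auto simp: lift_def insert_absorb)
    then show ?thesis using eb_sym contracted.eb_sym by metis
  next
    case 3
    then show ?thesis using S unfolding lift_def by (auto intro!: eb_cong w'_old)
  qed
qed

lemma lift_subset: "S \<subseteq> insert u K \<Longrightarrow> lift S \<subseteq> V"
  using V_eq by (auto simp: lift_def)

lemma lift_Diff: "S \<subseteq> insert u K \<Longrightarrow> T \<subseteq> S \<Longrightarrow> lift (S - T) = lift S - lift T"
  using disjoint new V_eq by (auto simp: lift_def)

lemma lift_ne: "S \<subseteq> insert u K \<Longrightarrow> S \<noteq> {} \<Longrightarrow> lift S \<noteq> {}"
  using C_ne by (auto simp: lift_def)

lemma lift_top: "lift (insert u K) = V"
  using V_eq new by (auto simp: lift_def)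

lemma exact_contracted:
  assumes "\<And>x. x \<in> K \<Longrightarrow> \<exists>A \<subseteq> K. x \<in> A \<and> cut A = 3"
    and "\<And>x y. x \<in> K \<Longrightarrow> y \<in> K \<Longrightarrow> x \<noteq> y \<Longrightarrow> \<exists>A \<subseteq> K. cut A = 3 \<and> (x \<in> A) \<noteq> (y \<in> A)"
  shows "exact_cuts 3 (insert u K) w'"
  unfolding exact_cuts_def
proof (intro conjI allI impI ballI)
  let ?V = "insert u K"
  have cut_lift: "edges_between w' S (?V - S) = cut (lift S)" if "S \<subseteq> ?V" for S
    using eb_lift[of S "?V - S"] lift_Diff[of ?V S] lift_top that by auto
  fix S assume S: "S \<subseteq> ?V" "S \<noteq> {}" "S \<noteq> ?V"
  have "lift (?V - S) \<noteq> {}" using S by (intro lift_ne) auto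
  then have "lift S \<noteq> V" using lift_Diff[of ?V S] S lift_top by auto
  then show "3 \<le> edges_between w' S (?V - S)"
    using cut_lift S lift_subset lift_ne cut_ge by simp
next
  let ?V = "insert u K"
  fix x y assume xy: "x \<in> ?V" "y \<in> ?V" "x \<noteq> y"
  have uK: "u \<notin> K" using new V_eq by auto
  have "\<exists>A \<subseteq> K. cut A = 3 \<and> (x \<in> A) \<noteq> (y \<in> A)"
  proof -
    consider "x \<in> K" "y \<in> K" | "x = u" "y \<in> K" | "x \<in> K" "y = u" using xy by blast
    then show ?thesis
    proof cases
      case 1 then show ?thesis using assms(2) xy by blast
    next
      case 2 then show ?thesis using assms(1)[of y] uK by blast
    next
      case 3 then show ?thesis using assms(1)[of x] uK by blast
    qed
  qed
  then obtain A where A: "A \<subseteq> K" "cut A = 3" "(x \<in> A) \<noteq> (y \<in> A)" by blast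
  have "lift A = A" using A uK by (auto simp: lift_def)
  moreover have "lift (?V - A) = V - A" using lift_Diff[of ?V A] lift_top A \<open>lift A = A\<close> by auto
  ultimately have cutA: "edges_between w' A (?V - A) = 3"
    using eb_lift[of A "?V - A"] A by auto
  show "\<exists>S. S \<subseteq> ?V \<and> x \<in> S \<and> y \<notin> S \<and> edges_between w' S (?V - S) = 3"
  proof (cases "x \<in> A")
    case True
    then show ?thesis using A cutA by (intro exI[of _ A]) auto
  next
    case False
    have "?V - (?V - A) = A" using A by auto
    then have "edges_between w' (?V - A) (?V - (?V - A)) = 3" using cutA contracted.eb_sym by simp
    then show ?thesis using A False xy by (intro exI[of _ "?V - A"]) auto
  qed
qed

lemma connected_contracted:
  assumes biconn: "\<And>v. v \<in> V \<Longrightarrow> connected_on w (V - {v})" and K: "connected_on w K"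
    and v: "v \<in> insert u K"
  shows "connected_on w' (insert u K - {v})"
proof (cases "v = u")
  case True
  moreover have "insert u K - {u} = K" using new V_eq by auto
  ultimately show ?thesis using K connected_on_cong[of K w' w] w'_old by simp
next
  case False
  then have vK: "v \<in> K" using v by auto
  let ?V = "insert u K - {v}"
  have top: "lift ?V = V - {v}" using lift_Diff[of "insert u K" "{v}"] lift_top vK False by (auto simp: lift_def)
  show ?thesis unfolding connected_on_def
  proof (intro allI impI)
    fix A assume A: "A \<subseteq> ?V" "A \<noteq> {}" "A \<noteq> ?V"
    have d: "lift (?V - A) = V - {v} - lift A" using lift_Diff[of ?V A] top A by auto
    have "lift (?V - A) \<noteq> {}" using A by (intro lift_ne) auto
    moreover have "lift A \<noteq> {}" using A by (intro lift_ne) auto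
    moreover have "lift A \<subseteq> V - {v}" using A V_eq vK disjoint by (auto simp: lift_def)
    moreover have "connected_on w (V - {v})" using biconn vK V_eq by blast
    ultimately have "0 < eb (lift A) (V - {v} - lift A)"
      unfolding d by (intro connected_onD) auto
    moreover have "A \<subseteq> insert u K" "?V - A \<subseteq> insert u K" using A by auto
    ultimately show "0 < edges_between w' A (?V - A)" using eb_lift[of A "?V - A"] d by simp
  qed
qed

end

section \<open>Translation to multigraphs\<close>
lemma exact_cuts_cong:
  assumes "\<And>x y. x \<in> V \<Longrightarrow> y \<in> V \<Longrightarrow> w x y = w' x y"
  shows "exact_cuts k V w \<longleftrightarrow> exact_cuts k V w'"
proof -
  have "edges_between w A (V - A) = edges_between w' A (V - A)" if "A \<subseteq> V" for A
    using that by (intro eb_cong assms) auto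
  then show ?thesis unfolding exact_cuts_def
    by (intro conj_cong all_cong1 imp_cong ball_cong ex_cong1 refl) simp_all
qed

lemma exactly_three_connected_weight:
  assumes "multigraph G" "exactly_edge_connected 3 G"
  shows "exactly_three_connected (weight G) (verts G)"
proof -
  interpret multiplicity "weight G" using multiplicity_weight assms by blast
  show ?thesis
    using assms exactly_edge_connected_iff[of G 3] by unfold_locales (auto simp: multigraph_def)
qed

lemma weight_remove_vertex:
  "x \<noteq> u \<Longrightarrow> y \<noteq> u \<Longrightarrow> weight (remove_vertex G u) x y = weight G x y"
  by (simp add: weight_def remove_vertex_def)

lemma multigraph_remove_vertex: "multigraph G \<Longrightarrow> multigraph (remove_vertex G u)"
  by (auto simp: multigraph_def remove_vertex_def)

lemma connected_remove_vertex_iff: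
  assumes "multigraph G"
  shows "connected_mgraph (remove_vertex G u) \<longleftrightarrow> connected_on (weight G) (verts G - {u})"
proof -
  have "connected_mgraph (remove_vertex G u) \<longleftrightarrow>
      connected_on (weight (remove_vertex G u)) (verts G - {u})"
    using connected_mgraph_iff[OF multigraph_remove_vertex[OF assms], of u] by (simp add: remove_vertex_def)
  also have "\<dots> \<longleftrightarrow> connected_on (weight G) (verts G - {u})"
    by (intro connected_on_cong weight_remove_vertex) auto
  finally show ?thesis .
qed

lemma biconnected_iff:
  assumes "multigraph G"
  shows "biconnected G \<longleftrightarrow> connected_on (weight G) (verts G) \<and>
    (\<forall>v\<in>verts G. connected_on (weight G) (verts G - {v}))"
  unfolding biconnected_def articulation_point_def connected_mgraph_iff[OF assms]
    connected_remove_vertex_iff[OF assms] by blast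

lemma mset_of_pairs_eqI:
  assumes "\<And>e. e \<in># E \<Longrightarrow> e \<subseteq> V \<and> card e = 2" "\<And>e. e \<in># F \<Longrightarrow> e \<subseteq> V \<and> card e = 2"
    and eq: "\<And>x y. x \<in> V \<Longrightarrow> y \<in> V \<Longrightarrow> x \<noteq> y \<Longrightarrow> count E {x, y} = count F {x, y}"
  shows "E = F"
proof (rule multiset_eqI)
  fix e
  show "count E e = count F e"
  proof (cases "e \<subseteq> V \<and> card e = 2")
    case True
    then obtain x y where "e = {x, y}" "x \<noteq> y" by (auto simp: card_2_iff)
    then show ?thesis using eq True by auto
  next
    case False
    then have "e \<notin># E" "e \<notin># F" using assms by auto
    then show ?thesis by (simp add: not_in_iff)
  qed
qed

lemma dumbbell_if_two_vertices:
  assumes G: "multigraph G" "exactly_edge_connected 3 G" and "card (verts G) = 2"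
  shows "\<exists>a b. a \<noteq> b \<and> G = dumbbell a b"
proof -
  interpret exactly_three_connected "weight G" "verts G" using exactly_three_connected_weight G .
  obtain a b where ab: "verts G = {a, b}" "a \<noteq> b" using assms by (auto simp: card_2_iff)
  then obtain A where A: "tight A" "a \<in> A" "b \<notin> A" using separating by blast
  have "A \<subseteq> {a, b}" using A(1) ab(1) unfolding tight_def by blast
  then have "A = {a}" using A(2,3) by blast
  moreover have "verts G - {a} = {b}" using ab by blast
  ultimately have "eb {a} {b} = 3" using A(1) by (simp only: tight_def)
  then have w: "weight G a b = 3" by (simp add: eb_singleton)
  have "edges G = replicate_mset 3 {a, b}"
  proof (rule mset_of_pairs_eqI[of _ "{a, b}"])
    show "e \<subseteq> {a, b} \<and> card e = 2" if "e \<in># edges G" for e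
      using G that ab by (auto simp: multigraph_def)
    show "e \<subseteq> {a, b} \<and> card e = 2" if "e \<in># replicate_mset 3 {a, b}" for e
      using that ab by (auto simp: in_replicate_mset split: if_splits)
    show "count (edges G) {x, y} = count (replicate_mset 3 {a, b}) {x, y}"
      if "x \<in> {a, b}" "y \<in> {a, b}" "x \<noteq> y" for x y
    proof -
      have "{x, y} = {a, b}" using that by auto
      then show ?thesis using w by (simp add: weight_def)
    qed
  qed
  then show ?thesis using ab by (intro exI[of _ a] exI[of _ b]) (simp add: dumbbell_def)
qed

definition induced :: "'a mgraph \<Rightarrow> 'a set \<Rightarrow> 'a mgraph" where
  "induced G S = \<lparr>verts = S, edges = {#e \<in># edges G. e \<subseteq> S#}\<rparr>"

lemma induced_exact:
  assumes G: "multigraph G" and S: "S \<subseteq> verts G" "2 \<le> card S" "exact_cuts 3 S (weight G)"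
  shows "multigraph (induced G S)" "exactly_edge_connected 3 (induced G S)"
proof -
  show m: "multigraph (induced G S)"
    using G S by (auto simp: multigraph_def induced_def intro: finite_subset)
  have "exact_cuts 3 S (weight (induced G S)) \<longleftrightarrow> exact_cuts 3 S (weight G)"
    by (rule exact_cuts_cong) (simp add: weight_def induced_def)
  then show "exactly_edge_connected 3 (induced G S)"
    using S exactly_edge_connected_iff[OF m, of 3] by (simp add: induced_def)
qed

lemma disconnected_split:
  assumes "\<not> connected_on w S"
  obtains A B where "S = A \<union> B" "A \<inter> B = {}" "A \<noteq> {}" "B \<noteq> {}" "edges_between w A B = 0"
proof -
  obtain A where "A \<subseteq> S" "A \<noteq> {}" "A \<noteq> S" "edges_between w A (S - A) = 0"
    using assms unfolding connected_on_def by blast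
  then show thesis using that[of A "S - A"] by blast
qed

text \<open>The second side needs a fresh name \<open>u'\<close> for the articulation point, which gluing identifies with \<open>u\<close>
  again.\<close>
lemma gluing_of_sides:
  assumes G: "multigraph G" and V: "verts G = insert u (A \<union> B)" "u \<notin> A" "u \<notin> B" "A \<inter> B = {}"
    and zero: "edges_between (weight G) A B = 0" and new: "u' \<notin> verts G"
  defines "f \<equiv> id(u := u')"
  shows "G = block_gluing (induced G (insert u A)) u
    \<lparr>verts = f ` insert u B, edges = image_mset (image f) (edges (induced G (insert u B)))\<rparr> u'"
    (is "G = block_gluing ?G1 u ?G2 u'")
proof -
  let ?h = "id(u' := u)"
  have fin: "finite A" "finite B" using G V by (auto simp: multigraph_def)
  have u': "u' \<noteq> u" "u' \<notin> A" "u' \<notin> B" using new V by auto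
  have h1: "?h ` S = S" if S: "S \<subseteq> insert u A" for S
  proof -
    have "?h ` S = (\<lambda>x. x) ` S" by (rule image_cong) (use S u' in auto)
    also have "\<dots> = S" by simp
    finally show ?thesis .
  qed
  have h2: "?h ` f ` S = S" if S: "S \<subseteq> insert u B" for S
  proof -
    have "?h ` f ` S = (\<lambda>x. ?h (f x)) ` S" by (rule image_image)
    also have "\<dots> = (\<lambda>x. x) ` S" by (rule image_cong) (use S u' in \<open>auto simp: f_def\<close>)
    also have "\<dots> = S" by simp
    finally show ?thesis .
  qed
  have "\<not> e \<subseteq> insert u A \<longleftrightarrow> e \<subseteq> insert u B" if e: "e \<in># edges G" for e
  proof -
    have eV: "e \<subseteq> verts G" "card e = 2" using G e by (auto simp: multigraph_def)
    then obtain x y where xy: "e = {x, y}" "x \<noteq> y" by (metis card_2_iff)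
    have xyV: "x \<in> insert u (A \<union> B)" "y \<in> insert u (A \<union> B)" using eV xy V by auto
    have no_edge: "e \<noteq> {a, b}" if "a \<in> A" "b \<in> B" for a b
    proof
      assume "e = {a, b}"
      then have "0 < weight G a b" using e by (simp add: weight_def)
      then have "0 < edges_between (weight G) A B" using that eb_pos_iff[OF fin, of "weight G"] by blast
      then show False using zero by simp
    qed
    have "\<not> (x \<in> A \<and> y \<in> B)" "\<not> (y \<in> A \<and> x \<in> B)"
      using no_edge[of x y] no_edge[of y x] xy by (auto simp: insert_commute)
    then show ?thesis using xy xyV V(2-4) by blast
  qed
  then have "{#e \<in># edges G. \<not> e \<subseteq> insert u A#} = {#e \<in># edges G. e \<subseteq> insert u B#}"
    by (intro filter_mset_cong) auto
  then have E: "edges G = edges ?G1 + edges (induced G (insert u B))"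
    using multiset_partition[of "edges G" "\<lambda>e. e \<subseteq> insert u A"] by (simp add: induced_def)
  have e1: "image_mset (image ?h) (edges ?G1) = edges ?G1"
  proof -
    have "image_mset (image ?h) (edges ?G1) = image_mset id (edges ?G1)"
      by (intro image_mset_cong) (auto simp: induced_def h1 simp del: fun_upd_apply)
    then show ?thesis by simp
  qed
  have e2: "image_mset (image ?h) (image_mset (image f) (edges (induced G (insert u B)))) = edges (induced G (insert u B))"
  proof -
    have "image_mset (\<lambda>e. ?h ` f ` e) (edges (induced G (insert u B))) = image_mset id (edges (induced G (insert u B)))"
      by (intro image_mset_cong) (auto simp: induced_def h2 simp del: fun_upd_apply)
    then show ?thesis by (simp add: multiset.map_comp comp_def del: fun_upd_apply)
  qed
  have "?h ` (verts ?G1 \<union> f ` insert u B) = verts G"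
    unfolding image_Un using h1[of "insert u A"] h2[of "insert u B"] V by (auto simp: induced_def)
  then show ?thesis unfolding block_gluing_def Let_def using E e1 e2
    by (simp del: fun_upd_apply)
qed

section \<open>Cycle expansion as the inverse of contraction\<close>

lemma path_edges_conv_nth:
  "path_edges p = mset (map (\<lambda>i. {p ! i, p ! Suc i}) [0..<length p - 1])"
proof (induction p rule: path_edges.induct)
  case (1 x y xs)
  have "[0..<length (x # y # xs) - 1] = 0 # map Suc [0..<length (y # xs) - 1]"
    by (simp add: upt_conv_Cons map_Suc_upt del: upt_Suc)
  then show ?case using 1 by (simp add: comp_def del: upt_Suc)
qed simp_all

lemma cycle_edges_snoc:
  assumes "L \<noteq> []"
  shows "cycle_edges (L @ [s]) = add_mset {s, hd L} (path_edges (L @ [s]))"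
proof -
  let ?p = "L @ [s]"
  have "map (\<lambda>i. {?p ! i, ?p ! (Suc i mod length ?p)}) [0..<length ?p] =
      map (\<lambda>i. {?p ! i, ?p ! Suc i}) [0..<length L] @ [{s, hd L}]" (is "?l = ?r")
  proof (rule nth_equalityI)
    fix i assume "i < length ?l"
    then consider "i < length L" | "i = length L" by fastforce
    then show "?l ! i = ?r ! i"
    proof cases
      case 1 then show ?thesis by (simp add: nth_append del: upt_Suc)
    next
      case 2
      then show ?thesis using assms by (simp add: nth_append hd_conv_nth del: upt_Suc)
    qed
  qed simp
  then show ?thesis unfolding cycle_edges_def path_edges_conv_nth by (simp only: mset_append) simp
qed

lemma count_image_mset_inj_on:
  assumes "inj_on f A" "set_mset M \<subseteq> A" "a \<in> A"
  shows "count (image_mset f M) (f a) = count M a"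
  using assms(2)
proof (induction M)
  case (add b M)
  then have "f a = f b \<longleftrightarrow> a = b" using assms(1,3) by (auto dest: inj_onD)
  then show ?case using add by auto
qed simp

lemma cycle_expansion_snoc:
  assumes "length vs = length L" "ts \<noteq> []"
  shows "cycle_expansion G u (vs @ ts) (L @ [s]) =
    \<lparr>verts = (verts G - {u}) \<union> insert s (set L),
     edges = edges (remove_vertex G u) + cycle_edges (L @ [s])
       + mset (map (\<lambda>(x, y). {x, y}) (zip L vs)) + mset (map (\<lambda>t. {s, t}) ts)\<rparr>"
proof -
  have a: "map (\<lambda>i. {(L @ [s]) ! i, (vs @ ts) ! i}) [0..<length L] = map (\<lambda>(x, y). {x, y}) (zip L vs)"
    using assms by (intro nth_equalityI) (simp_all add: nth_append)
  have b: "map (\<lambda>i. {(L @ [s]) ! length L, (vs @ ts) ! i}) [length L..<length L + length ts] = map (\<lambda>t. {s, t}) ts"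
    using assms by (intro nth_equalityI) (simp_all add: nth_append)
  show ?thesis unfolding cycle_expansion_def Let_def using a b assms by simp
qed

text \<open>Everything outside \<open>K\<close> is contracted to \<open>u\<close>; the list \<open>vs\<close> enumerates the ends in \<open>K\<close> of the edges that
  lead out of \<open>K\<close>. The order of \<open>vs\<close> determines how a cycle expansion at \<open>u\<close> distributes these edges.\<close>
definition contract_outside :: "'a mgraph \<Rightarrow> 'a set \<Rightarrow> 'a \<Rightarrow> 'a list \<Rightarrow> 'a mgraph" where
  "contract_outside G K u vs =
     \<lparr>verts = insert u K, edges = {#e \<in># edges G. e \<subseteq> K#} + mset (map (\<lambda>k. {u, k}) vs)\<rparr>"

lemma neighbors_contract_outside:
  assumes "u \<notin> K" "set vs \<subseteq> K"
  shows "neighbors (contract_outside G K u vs) u = mset vs"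
proof -
  have 1: "{#e \<in># {#e \<in># edges G. e \<subseteq> K#}. u \<in> e#} = {#}"
    using assms by (auto simp: filter_mset_eq_conv filter_filter_mset)
  have 2: "image_mset (\<lambda>e. the_elem (e - {u})) {#e \<in># mset (map (\<lambda>k. {u, k}) vs). u \<in> e#} = mset vs"
    using assms(2)
  proof (induction vs)
    case (Cons v vs)
    then have "{u, v} - {u} = {v}" using assms(1) by auto
    then show ?case using Cons by simp
  qed simp
  show ?thesis unfolding neighbors_def contract_outside_def using 1 2 by simp
qed

lemma weight_contract_outside:
  assumes "u \<notin> K" "set vs \<subseteq> K" and "y \<in> K"
  shows "x \<in> K \<Longrightarrow> weight (contract_outside G K u vs) x y = weight G x y"
    and "weight (contract_outside G K u vs) u y = count (mset vs) y"
proof -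
  assume x: "x \<in> K"
  then have "{x, y} \<notin># mset (map (\<lambda>k. {u, k}) vs)" using assms by auto
  then have "count (mset (map (\<lambda>k. {u, k}) vs)) {x, y} = 0" by (simp only: not_in_iff)
  then show "weight (contract_outside G K u vs) x y = weight G x y"
    using x assms by (simp add: weight_def contract_outside_def)
next
  have "inj_on (\<lambda>k. {u, k}) K" using assms(1) by (auto simp: inj_on_def doubleton_eq_iff)
  then have "count (image_mset (\<lambda>k. {u, k}) (mset vs)) {u, y} = count (mset vs) y"
    using count_image_mset_inj_on[of "\<lambda>k. {u, k}" K "mset vs" y] assms by simp
  then show "weight (contract_outside G K u vs) u y = count (mset vs) y"
    using assms by (simp add: weight_def contract_outside_def)
qed

lemma multigraph_contract_outside:
  assumes "multigraph G" "K \<subseteq> verts G" "u \<notin> K" "set vs \<subseteq> K"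
  shows "multigraph (contract_outside G K u vs)"
  using assms finite_subset[of K "verts G"]
  by (auto simp: multigraph_def contract_outside_def card_insert_if)

lemma remove_vertex_contract_outside:
  assumes "u \<notin> K"
  shows "edges (remove_vertex (contract_outside G K u vs) u) = {#e \<in># edges G. e \<subseteq> K#}"
proof -
  have "{#e \<in># mset (map (\<lambda>k. {u, k}) vs). u \<notin> e#} = {#}" by (induction vs) auto
  moreover have "{#e \<in># {#e \<in># edges G. e \<subseteq> K#}. u \<notin> e#} = {#e \<in># edges G. e \<subseteq> K#}"
    using assms by (auto simp: filter_filter_mset intro!: filter_mset_cong)
  ultimately show ?thesis by (simp add: remove_vertex_def contract_outside_def)
qed

text \<open>The list \<open>vs\<close> begins with the unique neighbours in \<open>K\<close> of the vertices of \<open>L\<close>, in the order of \<open>L\<close>, and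
  continues with the neighbours of \<open>s\<close>, because an expansion attaches all remaining edges to the last
  vertex of the cycle. The cycle may be a digon: then \<open>L\<close> has one vertex, which is joined to \<open>s\<close> by two
  parallel edges.\<close>
lemma expansion_of_contraction:
  assumes G: "multigraph G" and V: "verts G = K \<union> insert s (set L)" "K \<inter> insert s (set L) = {}"
    and L: "s \<notin> set L" "distinct L" "L \<noteq> []" and new: "u \<notin> verts G"
    and wL: "\<forall>x\<in>set L. \<forall>y\<in>set L. weight G x y = count (path_edges L) {x, y}"
    and ws: "\<forall>v\<in>set L. weight G s v = of_bool (v = hd L) + of_bool (v = last L)"
    and one: "\<forall>v\<in>set L. edges_between (weight G) {v} K = 1"
    and sK: "1 \<le> edges_between (weight G) {s} K"
  obtains vs where "set vs \<subseteq> K" "length (L @ [s]) \<le> length vs"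
    "\<forall>y\<in>K. count (mset vs) y = edges_between (weight G) (insert s (set L)) {y}"
    "G = cycle_expansion (contract_outside G K u vs) u vs (L @ [s])"
proof -
  interpret multiplicity "weight G" using multiplicity_weight[OF G] .
  have finK: "finite K" using G V by (auto simp: multigraph_def)
  have "\<exists>a\<in>K. \<forall>y\<in>K. weight G v y = of_bool (y = a)" if "v \<in> set L" for v
  proof -
    have "sum (weight G v) K = 1" using one that by (simp add: eb_singleton(1))
    then obtain a where "a \<in> K" "weight G v a = 1" "\<forall>y\<in>K. a \<noteq> y \<longrightarrow> weight G v y = 0"
      using sum_eq_1_iff[OF finK, of "weight G v"] by auto
    then show ?thesis by (intro bexI[of _ a]) auto
  qed
  then obtain f where f: "\<And>v. v \<in> set L \<Longrightarrow> f v \<in> K"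
      "\<And>v y. v \<in> set L \<Longrightarrow> y \<in> K \<Longrightarrow> weight G v y = of_bool (y = f v)" by metis
  obtain ts where ts: "mset ts = (\<Sum>y\<in>K. replicate_mset (weight G s y) y)" using ex_mset by blast
  have count_ts: "count (mset ts) y = (if y \<in> K then weight G s y else 0)" for y
    unfolding ts using finK by (simp add: count_sum)
  have setts: "set ts \<subseteq> K"
  proof
    fix y assume "y \<in> set ts"
    then have "0 < count (mset ts) y" by simp
    then show "y \<in> K" using count_ts[of y] by (metis less_irrefl)
  qed
  have ts_ne: "ts \<noteq> []"
  proof
    assume "ts = []"
    then have "weight G s y = 0" if "y \<in> K" for y using count_ts[of y] that by simp
    then show False using sK by (simp add: eb_singleton)
  qed
  define vs where "vs = map f L @ ts"
  have setvs: "set vs \<subseteq> K" using f setts by (auto simp: vs_def)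
  have uK: "u \<notin> K" using new V by auto
  have count_vs: "count (mset vs) y = eb (insert s (set L)) {y}" if y: "y \<in> K" for y
  proof -
    have "count (mset (map f M)) y = (\<Sum>v\<in>set M. weight G v y)" if "distinct M" "set M \<subseteq> set L" for M
      using that f(2) y by (induction M) auto
    then have "count (mset (map f L)) y = (\<Sum>v\<in>set L. weight G v y)" using L by blast
    then show ?thesis using L count_ts[of y] y by (simp add: vs_def eb_singleton)
  qed
  let ?G' = "contract_outside G K u vs"
  let ?C = "insert s (set L)"
  define M where "M = {#e \<in># edges G. e \<subseteq> K#}"
  define Y where "Y = cycle_edges (L @ [s])"
  define S1 where "S1 = mset (map (\<lambda>v. {v, f v}) L)"
  define S2 where "S2 = mset (map (\<lambda>t. {s, t}) ts)"
  have zip: "map (\<lambda>(x, y). {x, y}) (zip L (map f L)) = map (\<lambda>v. {v, f v}) L"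
    by (induction L) auto
  have exp: "cycle_expansion ?G' u vs (L @ [s]) = \<lparr>verts = verts G, edges = M + Y + S1 + S2\<rparr>"
  proof -
    have "verts ?G' - {u} = K" using uK by (auto simp: contract_outside_def)
    then show ?thesis
      using cycle_expansion_snoc[of "map f L" L ts ?G' u s] ts_ne V
      by (simp add: vs_def[symmetric] zip remove_vertex_contract_outside[OF uK] M_def Y_def S1_def S2_def)
  qed
  have Y_in: "e \<subseteq> ?C \<and> card e = 2" if "e \<in># Y" for e
  proof -
    have "e = {s, hd L} \<or> e \<in># path_edges (L @ [s])" using that cycle_edges_snoc[OF L(3)] by (auto simp: Y_def)
    then show ?thesis
    proof
      assume "e = {s, hd L}"
      then show ?thesis using L by (cases L) auto
    next
      assume e: "e \<in># path_edges (L @ [s])"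
      have "distinct (L @ [s])" using L by simp
      then show ?thesis using path_edges_subset[OF e] count_path_edges_card[OF _ e] by auto
    qed
  qed
  have S1_in: "\<exists>v\<in>set L. e = {v, f v}" if "e \<in># S1" for e using that by (auto simp: S1_def)
  have S2_in: "\<exists>t\<in>K. e = {s, t}" if "e \<in># S2" for e using that setts by (auto simp: S2_def)
  have "edges G = M + Y + S1 + S2"
  proof (rule mset_of_pairs_eqI[of _ "verts G"])
    show "e \<subseteq> verts G \<and> card e = 2" if "e \<in># edges G" for e using G that by (auto simp: multigraph_def)
    show "e \<subseteq> verts G \<and> card e = 2" if e: "e \<in># M + Y + S1 + S2" for e
    proof -
      have pair: "{x, y} \<subseteq> verts G \<and> card {x, y} = 2" if "x \<in> ?C" "y \<in> K" for x y
      proof -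
        have "x \<noteq> y" using that V(2) by blast
        then show ?thesis using that V(1) by auto
      qed
      consider "e \<in># M" | "e \<in># Y" | "e \<in># S1" | "e \<in># S2" using e by auto
      then show ?thesis
      proof cases
        case 1 then show ?thesis using G by (auto simp: M_def multigraph_def)
      next
        case 2 then show ?thesis using Y_in V(1) by blast
      next
        case 3 then show ?thesis using S1_in pair f(1) by blast
      next
        case 4 then show ?thesis using S2_in pair by blast
      qed
    qed
  next
    have M0: "count M e = 0" if "\<not> e \<subseteq> K" for e using that by (simp add: M_def)
    have Y0: "count Y e = 0" if "\<not> e \<subseteq> ?C" for e using that Y_in[of e] by (meson not_in_iff)
    have S10: "count S1 e = 0" if "e \<subseteq> ?C \<or> e \<subseteq> K \<or> s \<in> e" for e
    proof -
      have "e \<notin># S1" using S1_in[of e] that V(2) f(1) L(1) by blast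
      then show ?thesis by (simp only: not_in_iff)
    qed
    have S20: "count S2 e = 0" if "e \<subseteq> ?C \<or> e \<subseteq> K \<or> s \<notin> e" for e
    proof -
      have "e \<notin># S2" using S2_in[of e] that V(2) by blast
      then show ?thesis by (simp only: not_in_iff)
    qed
    have mixed: "count (edges G) {x, y} = count (M + Y + S1 + S2) {x, y}" if x: "x \<in> ?C" and y: "y \<in> K" for x y
    proof -
      have ny: "y \<notin> ?C" and nx: "x \<notin> K" using x y V(2) by auto
      have "count M {x, y} = 0" "count Y {x, y} = 0" using M0 Y0 nx ny by auto
      moreover have "count S1 {x, y} + count S2 {x, y} = weight G x y"
      proof (cases "x = s")
        case True
        have "inj_on (\<lambda>t. {s, t}) K" using x True nx by (auto simp: inj_on_def doubleton_eq_iff)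
        then have "count S2 {s, y} = count (mset ts) y"
          using count_image_mset_inj_on[of "\<lambda>t. {s, t}" K "mset ts" y] setts y by (simp add: S2_def)
        then show ?thesis using S10[of "{x, y}"] True count_ts[of y] y by simp
      next
        case False
        then have xL: "x \<in> set L" using x by auto
        have inj: "inj_on (\<lambda>v. {v, f v}) (set L)"
        proof (rule inj_onI)
          fix a b assume ab: "a \<in> set L" "b \<in> set L" "{a, f a} = {b, f b}"
          then have "a \<noteq> f b" using f(1)[of b] V(2) by blast
          then show "a = b" using ab(3) by (auto simp: doubleton_eq_iff)
        qed
        have cL: "count (mset L) x = 1" using L(2) xL by (simp add: distinct_count_atmost_1)
        have "count S1 {x, y} = of_bool (y = f x)"
        proof (cases "y = f x")
          case True
          then show ?thesis
            using count_image_mset_inj_on[OF inj, of "mset L" x] xL cL by (simp add: S1_def)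
        next
          case False
          have "{x, y} \<notin># S1"
          proof
            assume "{x, y} \<in># S1"
            then obtain v where v: "v \<in> set L" "{x, y} = {v, f v}" using S1_in by blast
            then have "y \<noteq> v" using ny by blast
            then show False using v False by (auto simp: doubleton_eq_iff)
          qed
          then have "count S1 {x, y} = 0" by (simp only: not_in_iff)
          then show ?thesis using False by simp
        qed
        moreover have "s \<notin> {x, y}" using False ny by auto
        ultimately show ?thesis using S20[of "{x, y}"] f(2)[OF xL y] by simp
      qed
      ultimately show ?thesis by (simp add: weight_def)
    qed
    have cycle: "count (edges G) {x, y} = count (M + Y + S1 + S2) {x, y}"
      if xy: "x \<in> ?C" "y \<in> set L" "x \<noteq> y" for x y
    proof -
      have sub: "{x, y} \<subseteq> ?C" using xy by auto
      have "\<not> {x, y} \<subseteq> K" using xy V(2) by blast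
      then have 0: "count M {x, y} = 0" "count S1 {x, y} = 0" "count S2 {x, y} = 0"
        using M0 S10[of "{x, y}"] S20[of "{x, y}"] sub by auto
      have cY: "count Y {x, y} = of_bool ({s, hd L} = {x, y}) + count (path_edges L) {x, y} + of_bool ({x, y} = {last L, s})"
        using L(3) by (simp add: Y_def cycle_edges_snoc count_path_edges_snoc)
      have "count Y {x, y} = weight G x y"
      proof (cases "x = s")
        case True
        have "count (path_edges L) {x, y} = 0" using True L(1) count_path_edges_notin by metis
        moreover have "{s, hd L} = {x, y} \<longleftrightarrow> y = hd L" "{x, y} = {last L, s} \<longleftrightarrow> y = last L"
          using True xy by (auto simp: doubleton_eq_iff)
        ultimately show ?thesis using cY bspec[OF ws xy(2)] True by simp
      next
        case False
        then have "x \<in> set L" using xy by auto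
        moreover have "s \<notin> {x, y}" using False xy L(1) by auto
        then have "{s, hd L} \<noteq> {x, y}" "{x, y} \<noteq> {last L, s}" by auto
        ultimately show ?thesis using cY wL xy by simp
      qed
      then show ?thesis using 0 by (simp add: weight_def)
    qed
    fix x y assume xy: "x \<in> verts G" "y \<in> verts G" "x \<noteq> y"
    consider "x \<in> K" "y \<in> K" | "x \<in> ?C" "y \<in> K" | "x \<in> K" "y \<in> ?C" | "x \<in> ?C" "y \<in> set L" | "x \<in> set L" "y \<in> ?C"
      using xy V(1) by blast
    then show "count (edges G) {x, y} = count (M + Y + S1 + S2) {x, y}"
    proof cases
      case 1
      then have "{x, y} \<subseteq> K" "\<not> {x, y} \<subseteq> ?C" using V(2) by blast+
      then show ?thesis using Y0 S10 S20 by (simp add: M_def)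
    next
      case 2 then show ?thesis by (rule mixed)
    next
      case 3 then show ?thesis using mixed[of y x] by (simp add: insert_commute)
    next
      case 4 then show ?thesis using xy(3) by (rule cycle)
    next
      case 5 then show ?thesis using cycle[of y x] xy(3) by (simp add: insert_commute)
    qed
  qed
  then have "G = cycle_expansion ?G' u vs (L @ [s])" unfolding exp by simp
  moreover have "length (L @ [s]) \<le> length vs" using ts_ne by (cases ts) (auto simp: vs_def)
  ultimately show thesis using that setvs count_vs by blast
qed

section \<open>Reduction to smaller graphs\<close>
lemma constructible_if_exactly_three:
  fixes G :: "nat mgraph"
  assumes "multigraph G" "exactly_edge_connected 3 G"
  shows "constructible G"
  using assms
proof (induction "card (verts G)" arbitrary: G rule: less_induct)
  case less
  note G = less.prems
  interpret exactly_three_connected "weight G" "verts G" using exactly_three_connected_weight[OF G] .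
  have card2: "2 \<le> card (verts G)" using G by (simp add: exactly_edge_connected_def)
  obtain u' where new: "u' \<notin> verts G" using ex_new_if_finite[OF infinite_UNIV_nat finite_V] by blast
  consider "card (verts G) = 2" | u where "u \<in> verts G" "\<not> connected_on (weight G) (verts G - {u})"
    | "3 \<le> card (verts G)" "\<And>u. u \<in> verts G \<Longrightarrow> connected_on (weight G) (verts G - {u})"
    using card2 by force
  then show ?case
  proof cases
    case 1
    then obtain a b where "a \<noteq> b" "G = dumbbell a b" using dumbbell_if_two_vertices G by blast
    then show ?thesis by (simp add: constructible_dumbbell)
  next
    case (2 u)
    obtain A B where AB: "verts G - {u} = A \<union> B" "A \<inter> B = {}" "A \<noteq> {}" "B \<noteq> {}"
      "edges_between (weight G) A B = 0" by (rule disconnected_split[OF 2(2)])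
    have V: "verts G = insert u (A \<union> B)" "u \<notin> A" "u \<notin> B" using AB(1) 2(1) by auto
    have fAB: "finite A" "finite B" using V finite_V by auto
    have side: "constructible (induced G (insert u S))"
      if S: "verts G = insert u (S \<union> T)" "u \<notin> S" "u \<notin> T" "S \<inter> T = {}" "edges_between (weight G) S T = 0"
        "S \<noteq> {}" "T \<noteq> {}" for S T
    proof -
      have "finite S" using S(1) finite_V by auto
      then have "2 \<le> card (insert u S)" using S(2,6) by (simp add: Suc_le_eq card_gt_0_iff)
      moreover have "insert u S \<subseteq> verts G" using S(1) by auto
      moreover have "insert u S \<subset> verts G" using S(1,3,4,7) by auto
      then have "card (insert u S) < card (verts G)" by (rule psubset_card_mono[OF finite_V])
      moreover have "exact_cuts 3 (insert u S) (weight G)" using exact_side S by blast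
      ultimately show ?thesis using less.hyps[of "induced G (insert u S)"] induced_exact[OF G(1), of "insert u S"]
        by (simp add: induced_def)
    qed
    have c1: "constructible (induced G (insert u A))" using side[of A B] V AB by simp
    have c2: "constructible (induced G (insert u B))"
      using side[of B A] V AB eb_sym[of B A] by (simp add: Un_commute Int_commute)
    let ?f = "id(u := u')"
    let ?G2 = "\<lparr>verts = ?f ` insert u B, edges = image_mset (image ?f) (edges (induced G (insert u B)))\<rparr>"
    have "inj_on ?f (insert u B)" using new V by (auto simp: inj_on_def)
    then have "mgraph_iso (induced G (insert u B)) ?G2"
      unfolding mgraph_iso_def by (intro exI[of _ ?f]) (simp add: induced_def bij_betw_def)
    then have c3: "constructible ?G2" using constructible_iso[OF c2] by blast
    have "verts (induced G (insert u A)) \<inter> verts ?G2 = {}"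
      using new V AB(2) by (auto simp: induced_def split: if_splits)
    then have "constructible (block_gluing (induced G (insert u A)) u ?G2 u')"
      using c1 c3 by (intro constructible_gluing) (auto simp: induced_def)
    then show ?thesis using gluing_of_sides[OF G(1) V AB(2,5) new] by simp
  next
    case 3
    obtain K s L where V: "verts G = K \<union> insert s (set L)" "K \<inter> insert s (set L) = {}"
      and L: "s \<notin> set L" "distinct L" "L \<noteq> []" and K: "K \<noteq> {}" "connected_on (weight G) K"
      and wL: "\<forall>x\<in>set L. \<forall>y\<in>set L. weight G x y = count (path_edges L) {x, y}"
      and ws: "\<forall>v\<in>set L. weight G s v = of_bool (v = hd L) + of_bool (v = last L)"
      and one: "\<forall>v\<in>set L. eb {v} K = 1" and sK: "1 \<le> eb {s} K"
      and sep1: "\<forall>x\<in>K. \<exists>A \<subseteq> K. x \<in> A \<and> cut A = 3"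
      and sep2: "\<forall>x\<in>K. \<forall>y\<in>K. x \<noteq> y \<longrightarrow> (\<exists>A \<subseteq> K. cut A = 3 \<and> (x \<in> A) \<noteq> (y \<in> A))"
      by (rule contractible_cycle[OF 3])
    obtain vs where vs: "set vs \<subseteq> K" "length (L @ [s]) \<le> length vs"
      and count_vs: "\<forall>y\<in>K. count (mset vs) y = eb (insert s (set L)) {y}"
      and G_eq: "G = cycle_expansion (contract_outside G K u' vs) u' vs (L @ [s])"
      by (rule expansion_of_contraction[OF G(1) V L new wL ws one sK])
    let ?G' = "contract_outside G K u' vs"
    have uK: "u' \<notin> K" using new V by auto
    have KV: "K \<subseteq> verts G" using V by auto
    have G': "multigraph ?G'" by (rule multigraph_contract_outside[OF G(1) KV uK vs(1)])
    have verts': "verts ?G' = insert u' K" by (simp add: contract_outside_def)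
    interpret G': multiplicity "weight ?G'" using multiplicity_weight[OF G'] .
    interpret contraction "weight G" "weight ?G'" "verts G" K "insert s (set L)" u'
      using V new weight_contract_outside[OF uK vs(1)] count_vs by unfold_locales auto
    have exact': "exact_cuts 3 (insert u' K) (weight ?G')"
      using exact_contracted sep1 sep2 by blast
    have finK: "finite K" using KV finite_V finite_subset by blast
    have "exactly_edge_connected 3 ?G'"
      using exactly_edge_connected_iff[OF G', of 3] exact' K uK finK
      by (simp add: verts' Suc_le_eq card_gt_0_iff)
    moreover have "card (verts ?G') < card (verts G)"
    proof -
      have "card (verts G) = card K + card (insert s (set L))"
        unfolding V(1) using finK V(2) by (intro card_Un_disjoint) auto
      moreover have "0 < card (set L)" using L(3) by (simp add: card_gt_0_iff)
      ultimately show ?thesis using L(1) uK finK verts' by simp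
    qed
    ultimately have c': "constructible ?G'" and e': "exactly_edge_connected 3 ?G'"
      using less.hyps[of ?G'] G' by auto
    interpret G'_exact: exactly_three_connected "weight ?G'" "verts ?G'"
      using exactly_three_connected_weight[OF G' e'] .
    have "biconnected ?G'"
      unfolding biconnected_iff[OF G']
    proof (intro conjI ballI)
      show "connected_on (weight ?G') (verts ?G')" by (rule G'_exact.connected)
      show "connected_on (weight ?G') (verts ?G' - {v})" if "v \<in> verts ?G'" for v
        using connected_contracted[OF 3(2) K(2), of v] that unfolding verts' by blast
    qed
    moreover have "mset vs = neighbors ?G' u'" using neighbors_contract_outside[OF uK vs(1)] by simp
    moreover have "distinct (L @ [s])" "set (L @ [s]) \<inter> verts ?G' = {}" "2 \<le> length (L @ [s])"
      using L V new verts' by (auto simp: Suc_le_eq)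
    ultimately have "constructible (cycle_expansion ?G' u' vs (L @ [s]))"
      using constructible_expansion[OF c' _ e', of u' vs "L @ [s]"] verts' vs(2) by simp
    then show ?thesis using G_eq by simp
  qed
qed

definition rename :: "('a \<Rightarrow> 'b) \<Rightarrow> 'a mgraph \<Rightarrow> 'b mgraph" where
  "rename g G = \<lparr>verts = g ` verts G, edges = image_mset (image g) (edges G)\<rparr>"

lemma multigraph_rename:
  assumes "multigraph G" "inj_on g (verts G)"
  shows "multigraph (rename g G)"
proof -
  have "card (g ` e) = card e" if "e \<in># edges G" for e
    using assms that by (intro card_image) (auto simp: multigraph_def intro: inj_on_subset)
  then show ?thesis using assms(1) by (auto simp: multigraph_def rename_def)
qed

lemma exactly_edge_connected_rename:
  assumes G: "multigraph G" and inj: "inj_on g (verts G)" and ex: "exactly_edge_connected k G"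
  shows "exactly_edge_connected k (rename g G)"
proof -
  let ?V = "verts G" and ?w = "weight G" and ?w' = "weight (rename g G)"
  have inj_sets: "inj_on (image g) (Pow ?V)" using inj by (rule inj_on_image_Pow)
  have w: "?w' (g x) (g y) = ?w x y" if xy: "x \<in> ?V" "y \<in> ?V" for x y
  proof -
    have "count (image_mset (image g) (edges G)) (g ` {x, y}) = count (edges G) {x, y}"
      using G xy by (intro count_image_mset_inj_on[OF inj_sets]) (auto simp: multigraph_def)
    then show ?thesis by (simp add: weight_def rename_def)
  qed
  have eb: "edges_between ?w' (g ` A) (g ` B) = edges_between ?w A B" if AB: "A \<subseteq> ?V" "B \<subseteq> ?V" for A B
  proof -
    have "edges_between ?w' (g ` A) (g ` B) = (\<Sum>x\<in>A. \<Sum>y\<in>B. ?w' (g x) (g y))"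
      unfolding edges_between_def using inj_on_subset[OF inj AB(1)] inj_on_subset[OF inj AB(2)]
      by (simp add: sum.reindex)
    also have "\<dots> = edges_between ?w A B"
      unfolding edges_between_def using AB w by (intro sum.cong refl) blast
    finally show ?thesis .
  qed
  have cut: "edges_between ?w' (g ` A) (g ` ?V - g ` A) = edges_between ?w A (?V - A)" if "A \<subseteq> ?V" for A
    using eb[of A "?V - A"] inj_on_image_set_diff[OF inj, of ?V A] that by simp
  have exG: "exact_cuts k ?V ?w" "2 \<le> card ?V" using ex exactly_edge_connected_iff[OF G] by auto
  have "exact_cuts k (g ` ?V) ?w'"
    unfolding exact_cuts_def
  proof (intro conjI allI impI ballI)
    fix S assume S: "S \<subseteq> g ` ?V" "S \<noteq> {}" "S \<noteq> g ` ?V"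
    then obtain A where A: "A \<subseteq> ?V" "S = g ` A" by (auto simp: subset_image_iff)
    then have "k \<le> edges_between ?w A (?V - A)" using exG(1) S unfolding exact_cuts_def by blast
    then show "k \<le> edges_between ?w' S (g ` ?V - S)" using cut A by simp
  next
    fix x' y' assume xy': "x' \<in> g ` ?V" "y' \<in> g ` ?V" "x' \<noteq> y'"
    then obtain x y where xy: "x' = g x" "y' = g y" "x \<in> ?V" "y \<in> ?V" "x \<noteq> y" by auto
    then obtain A where A: "A \<subseteq> ?V" "x \<in> A" "y \<notin> A" "edges_between ?w A (?V - A) = k"
      using exG(1) unfolding exact_cuts_def by blast
    have "g y \<notin> g ` A" using A xy inj by (auto dest: inj_onD)
    then show "\<exists>S. S \<subseteq> g ` ?V \<and> x' \<in> S \<and> y' \<notin> S \<and> edges_between ?w' S (g ` ?V - S) = k"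
      using A xy cut[of A] by (intro exI[of _ "g ` A"]) auto
  qed
  then show ?thesis
    using exactly_edge_connected_iff[OF multigraph_rename[OF G inj], of k] exG(2) card_image[OF inj]
    by (simp add: rename_def)
qed

lemma rename_iso:
  assumes G: "multigraph G" and inj: "inj_on g (verts G)"
  shows "mgraph_iso (rename g G) G"
  unfolding mgraph_iso_def
proof (intro exI conjI)
  let ?h = "inv_into (verts G) g"
  show "bij_betw ?h (verts (rename g G)) (verts G)"
    using inj by (simp add: rename_def bij_betw_inv_into inj_on_imp_bij_betw)
  have "image_mset (\<lambda>e. ?h ` g ` e) (edges G) = image_mset (\<lambda>e. e) (edges G)"
    using G inv_into_image_cancel[OF inj] by (intro image_mset_cong) (auto simp: multigraph_def)
  then show "edges G = image_mset (image ?h) (edges (rename g G))"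
    by (simp add: rename_def multiset.map_comp comp_def)
qed

theorem theorem17:
  fixes G :: "'a mgraph"
  assumes "multigraph G" and "exactly_edge_connected 3 G"
  shows "\<exists>H :: nat mgraph. constructible H \<and> mgraph_iso H G"
proof -
  obtain g :: "'a \<Rightarrow> nat" where inj: "inj_on g (verts G)"
    using assms(1) finite_imp_inj_to_nat_seg[of "verts G"] by (auto simp: multigraph_def)
  have "constructible (rename g G)"
    using constructible_if_exactly_three multigraph_rename exactly_edge_connected_rename assms inj by blast
  then show ?thesis using rename_iso[OF assms(1) inj] by blast
qed

end
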